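(* Let $\mu$ be a finite complex Borel measure on $\mathbb{C}$ without atoms. Assume that $C^{\mu}_*\in L^1(|\mu|)$, and that the principal value $C^{\mu}(z)$ exists and equals $0$ for $|\mu|$-almost every $z\in\mathbb{C}$. Then $\mu\equiv 0$.
   Context: For a finite complex Borel measure $\mu$ on $\mathbb{C}$, $\varepsilon>0$ and $z\in\mathbb{C}$, put $C^{\mu}_{\varepsilon}(z)=\int_{|\zeta-z|>\varepsilon}\frac{d\mu(\zeta)}{\zeta-z}$. The Cauchy integral (principal value) is $C^{\mu}(z)=\lim_{\varepsilon\to 0}C^{\mu}_{\varepsilon}(z)$ whenever the limit exists, and the Cauchy maximal function is $C^{\mu}_*(z)=\sup_{\varepsilon>0}|C^{\mu}_{\varepsilon}(z)|$. $|\mu|$ is the total variation measure. *)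

theory Defs
  imports "HOL-Analysis.Analysis"
begin

section \<open>Complex measures and their total variation\<close>

text \<open>
  A complex measure is a set function; only its values on \<^term>\<open>sets M\<close> matter.
  Since the values are complex numbers, it is automatically finite, and taking all
  \<open>A i\<close> empty forces \<open>\<mu> {} = 0\<close>.
\<close>

definition complex_measure :: "'a measure \<Rightarrow> ('a set \<Rightarrow> complex) \<Rightarrow> bool" where
  "complex_measure M \<mu> \<longleftrightarrow>
     (\<forall>A :: nat \<Rightarrow> 'a set. range A \<subseteq> sets M \<longrightarrow> disjoint_family A \<longrightarrow>
        (\<lambda>i. \<mu> (A i)) sums \<mu> (\<Union>i. A i))"

definition variation :: "'a measure \<Rightarrow> ('a set \<Rightarrow> complex) \<Rightarrow> 'a set \<Rightarrow> ennreal" where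
  "variation M \<mu> A =
     (SUP P\<in>{P. finite P \<and> partition_on A P \<and> P \<subseteq> sets M}. \<Sum>E\<in>P. ennreal (cmod (\<mu> E)))"

definition total_variation :: "'a measure \<Rightarrow> ('a set \<Rightarrow> complex) \<Rightarrow> 'a measure" where
  "total_variation M \<mu> = measure_of (space M) (sets M) (variation M \<mu>)"

text \<open>
  The positive part of the Jordan decomposition of a real measure \<open>\<nu>\<close>. The function
  \<^const>\<open>ennreal\<close> sends negative numbers to \<open>0\<close>, which does not affect the supremum
  because \<open>B = {}\<close> is admitted. The negative part of \<open>\<nu>\<close> is the positive part of \<open>- \<nu>\<close>.
\<close>

definition upper_variation :: "'a measure \<Rightarrow> ('a set \<Rightarrow> real) \<Rightarrow> 'a set \<Rightarrow> ennreal" where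
  "upper_variation M \<nu> A = (SUP B\<in>{B \<in> sets M. B \<subseteq> A}. ennreal (\<nu> B))"

definition positive_part :: "'a measure \<Rightarrow> ('a set \<Rightarrow> real) \<Rightarrow> 'a measure" where
  "positive_part M \<nu> = measure_of (space M) (sets M) (upper_variation M \<nu>)"

definition complex_measure_integral ::
    "'a measure \<Rightarrow> ('a set \<Rightarrow> complex) \<Rightarrow> ('a \<Rightarrow> complex) \<Rightarrow> complex" where
  "complex_measure_integral M \<mu> f =
     ((LINT x|positive_part M (\<lambda>A. Re (\<mu> A)). f x) - (LINT x|positive_part M (\<lambda>A. - Re (\<mu> A)). f x))
     + \<i> * ((LINT x|positive_part M (\<lambda>A. Im (\<mu> A)). f x) - (LINT x|positive_part M (\<lambda>A. - Im (\<mu> A)). f x))"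


section \<open>The Cauchy integral of a complex Borel measure\<close>

definition cauchy_truncated :: "(complex set \<Rightarrow> complex) \<Rightarrow> real \<Rightarrow> complex \<Rightarrow> complex" where
  "cauchy_truncated \<mu> \<epsilon> z =
     complex_measure_integral borel \<mu>
       (\<lambda>\<zeta>. indicator {\<zeta>. cmod (\<zeta> - z) > \<epsilon>} \<zeta> *\<^sub>R (1 / (\<zeta> - z)))"

definition has_cauchy_integral :: "(complex set \<Rightarrow> complex) \<Rightarrow> complex \<Rightarrow> complex \<Rightarrow> bool" where
  "has_cauchy_integral \<mu> z c \<longleftrightarrow> ((\<lambda>\<epsilon>. cauchy_truncated \<mu> \<epsilon> z) \<longlongrightarrow> c) (at_right 0)"

text \<open>The maximal function may take the value \<open>\<infinity>\<close>, hence the type \<^typ>\<open>ennreal\<close>.\<close>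

definition cauchy_maximal :: "(complex set \<Rightarrow> complex) \<Rightarrow> complex \<Rightarrow> ennreal" where
  "cauchy_maximal \<mu> z = (SUP \<epsilon>\<in>{0<..}. ennreal (cmod (cauchy_truncated \<mu> \<epsilon> z)))"


section \<open>The variations are measures\<close>

text \<open>
  \<^const>\<open>measure_of\<close> returns the zero measure when its argument is not countably additive.
  The lemmas \<open>emeasure_total_variation\<close> and \<open>emeasure_positive_part\<close> below show that
  this default value is never used for complex measures.
\<close>

lemma sets_total_variation [simp]: "sets (total_variation M \<mu>) = sets M"
  and space_total_variation [simp]: "space (total_variation M \<mu>) = space M"
  by (simp_all add: total_variation_def sets.space_closed sets.sigma_sets_eq)

lemma sets_positive_part [simp]: "sets (positive_part M \<nu>) = sets M"
  and space_positive_part [simp]: "space (positive_part M \<nu>) = space M"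
  by (simp_all add: positive_part_def sets.space_closed sets.sigma_sets_eq)

lemma complex_measure_empty:
  assumes "complex_measure M \<mu>" shows "\<mu> {} = 0"
proof -
  have "(\<lambda>i::nat. \<mu> {}) sums \<mu> {}"
    using assms[unfolded complex_measure_def, rule_format, of "\<lambda>_. {}"]
    by (simp add: disjoint_family_on_def)
  hence "summable (\<lambda>i::nat. \<mu> {})" by (rule sums_summable)
  thus ?thesis by (simp add: summable_const_iff)
qed

lemma SUP_add_SUP_le:
  fixes c :: ennreal
  assumes "I \<noteq> {}" "J \<noteq> {}" and le: "\<And>x y. x \<in> I \<Longrightarrow> y \<in> J \<Longrightarrow> f x + g y \<le> c"
  shows "(SUP x\<in>I. f x) + (SUP y\<in>J. g y) \<le> c"
proof -
  have "f x + (SUP y\<in>J. g y) \<le> c" if "x \<in> I" for x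
    unfolding ennreal_SUP_add_right[OF \<open>J \<noteq> {}\<close>] using that by (intro SUP_least le)
  thus ?thesis
    unfolding ennreal_SUP_add_left[OF \<open>I \<noteq> {}\<close>, symmetric] by (intro SUP_least)
qed

lemma countably_additiveI_super_sub:
  fixes F :: "'a set \<Rightarrow> ennreal"
  assumes super: "\<And>A B. A \<in> sets M \<Longrightarrow> B \<in> sets M \<Longrightarrow> A \<inter> B = {} \<Longrightarrow> F A + F B \<le> F (A \<union> B)"
    and sub: "\<And>A. range A \<subseteq> sets M \<Longrightarrow> disjoint_family A \<Longrightarrow> F (\<Union>i::nat. A i) \<le> (\<Sum>i. F (A i))"
    and "F {} = 0"
  shows "countably_additive (sets M) F"
  unfolding countably_additive_def
proof (intro allI impI antisym)
  fix A :: "nat \<Rightarrow> 'a set"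
  assume A: "range A \<subseteq> sets M" "disjoint_family A"
  have *: "(\<Sum>i<n. F (A i)) \<le> F (\<Union>i<n. A i)" for n
  proof (induction n)
    case (Suc n)
    have "A i \<inter> A n = {}" if "i < n" for i
      using A(2) that by (simp add: disjoint_family_on_def)
    hence "(\<Union>i<n. A i) \<inter> A n = {}" by blast
    moreover have "(\<Union>i<n. A i) \<in> sets M" "A n \<in> sets M" using A(1) by auto
    ultimately have "F (\<Union>i<n. A i) + F (A n) \<le> F ((\<Union>i<n. A i) \<union> A n)"
      by (intro super)
    moreover have "(\<Union>i<n. A i) \<union> A n = (\<Union>i<Suc n. A i)" by (auto simp: less_Suc_eq)
    ultimately have "F (\<Union>i<n. A i) + F (A n) \<le> F (\<Union>i<Suc n. A i)" by (simp only:)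
    moreover have "(\<Sum>i<Suc n. F (A i)) \<le> F (\<Union>i<n. A i) + F (A n)"
      unfolding sum.lessThan_Suc by (rule add_right_mono[OF Suc])
    ultimately show ?case by (rule order_trans[rotated])
  qed (simp add: assms)
  show "(\<Sum>i. F (A i)) \<le> F (\<Union>i. A i)"
  proof (rule suminf_le_const)
    fix n
    have "(\<Union>i<n. A i) \<in> sets M" "(\<Union>i. A i) - (\<Union>i<n. A i) \<in> sets M" using A(1) by auto
    hence "F (\<Union>i<n. A i) + F ((\<Union>i. A i) - (\<Union>i<n. A i))
             \<le> F ((\<Union>i<n. A i) \<union> ((\<Union>i. A i) - (\<Union>i<n. A i)))" by (intro super) auto
    moreover have "(\<Union>i<n. A i) \<union> ((\<Union>i. A i) - (\<Union>i<n. A i)) = (\<Union>i. A i)" by auto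
    ultimately have le: "F (\<Union>i<n. A i) + F ((\<Union>i. A i) - (\<Union>i<n. A i)) \<le> F (\<Union>i. A i)"
      by (simp only:)
    have "F (\<Union>i<n. A i) \<le> F (\<Union>i<n. A i) + F ((\<Union>i. A i) - (\<Union>i<n. A i))"
      by (rule add_increasing2) simp_all
    from order_trans[OF *[of n] order_trans[OF this le]]
    show "(\<Sum>i<n. F (A i)) \<le> F (\<Union>i. A i)" .
  qed (rule summableI)
  show "F (\<Union>i. A i) \<le> (\<Sum>i. F (A i))" using A by (rule sub)
qed

lemma emeasure_total_variation:
  assumes \<mu>: "complex_measure M \<mu>" and A: "A \<in> sets M"
  shows "emeasure (total_variation M \<mu>) A = variation M \<mu> A"
  unfolding total_variation_def
proof (rule emeasure_measure_of_sigma)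
  have E0: "\<mu> {} = 0" by (rule complex_measure_empty[OF \<mu>])
  have "{P::'a set set. finite P \<and> P = {} \<and> P \<subseteq> sets M} = {{}}" by auto
  hence V0: "variation M \<mu> {} = 0" by (simp add: variation_def partition_on_empty)
  thus "positive (sets M) (variation M \<mu>)" by (simp add: positive_def)
  let ?I = "\<lambda>A. {P. finite P \<and> partition_on A P \<and> P \<subseteq> sets M}"
  let ?S = "\<lambda>P. \<Sum>E\<in>P. ennreal (cmod (\<mu> E))"
  have ne: "?I A \<noteq> {}" if "A \<in> sets M" for A
  proof (cases "A = {}")
    case True
    have "{} \<in> ?I A" using True by (simp add: partition_on_empty)
    thus ?thesis by blast
  next
    case False
    have "{A} \<in> ?I A" using False that by (simp add: partition_on_space)
    thus ?thesis by blast
  qed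
  show "countably_additive (sets M) (variation M \<mu>)"
  proof (rule countably_additiveI_super_sub)
    fix A B assume AB: "A \<in> sets M" "B \<in> sets M" "A \<inter> B = {}"
    have "?S P + ?S Q \<le> variation M \<mu> (A \<union> B)" if P: "P \<in> ?I A" and Q: "Q \<in> ?I B" for P Q
    proof -
      have "P \<inter> Q = {}"
      proof (rule equals0I)
        fix E assume "E \<in> P \<inter> Q"
        hence "E \<subseteq> A \<inter> B" "E \<noteq> {}" using P Q by (auto simp: partition_on_def)
        thus False using AB(3) by simp
      qed
      hence "?S P + ?S Q = ?S (P \<union> Q)" using P Q by (intro sum.union_disjoint[symmetric]) auto
      moreover have "P \<union> Q \<in> ?I (A \<union> B)"
        using P Q AB(3) by (auto simp: partition_on_def intro!: disjoint_union)
      hence "?S (P \<union> Q) \<le> variation M \<mu> (A \<union> B)" unfolding variation_def by (rule SUP_upper)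
      ultimately show ?thesis by (simp only:)
    qed
    thus "variation M \<mu> A + variation M \<mu> B \<le> variation M \<mu> (A \<union> B)"
      unfolding variation_def[of M \<mu> A] variation_def[of M \<mu> B]
      by (intro SUP_add_SUP_le ne AB)
  next
    fix A :: "nat \<Rightarrow> 'a set"
    assume A: "range A \<subseteq> sets M" "disjoint_family A"
    show "variation M \<mu> (\<Union>i. A i) \<le> (\<Sum>i. variation M \<mu> (A i))"
      unfolding variation_def[of M \<mu> "\<Union>i. A i"]
    proof (rule SUP_least)
      fix P assume P: "P \<in> ?I (\<Union>i. A i)"
      have 1: "ennreal (cmod (\<mu> E)) \<le> (\<Sum>i. ennreal (cmod (\<mu> (A i \<inter> E))))" if "E \<in> P" for E
      proof -
        have "(\<lambda>i. \<mu> (A i \<inter> E)) sums \<mu> (\<Union>i. A i \<inter> E)"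
          using A P that
          by (intro \<mu>[unfolded complex_measure_def, rule_format])
             (auto simp: disjoint_family_on_def)
        moreover have "(\<Union>i. A i \<inter> E) = E" using P that by (auto simp: partition_on_def)
        ultimately have "(\<lambda>n. ennreal (cmod (\<Sum>i<n. \<mu> (A i \<inter> E)))) \<longlonglongrightarrow> ennreal (cmod (\<mu> E))"
          by (auto simp: sums_def intro!: tendsto_ennrealI tendsto_norm)
        thus ?thesis
        proof (rule LIMSEQ_le_const2, intro exI allI impI)
          fix n :: nat
          have "ennreal (cmod (\<Sum>i<n. \<mu> (A i \<inter> E))) \<le> ennreal (\<Sum>i<n. cmod (\<mu> (A i \<inter> E)))"
            by (intro ennreal_leI norm_sum)
          also have "\<dots> = (\<Sum>i<n. ennreal (cmod (\<mu> (A i \<inter> E))))" by (simp add: sum_ennreal)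
          also have "\<dots> \<le> (\<Sum>i. ennreal (cmod (\<mu> (A i \<inter> E))))" by (rule sum_le_suminf) auto
          finally show "ennreal (cmod (\<Sum>i<n. \<mu> (A i \<inter> E))) \<le> \<dots>" .
        qed
      qed
      have 2: "(\<Sum>E\<in>P. ennreal (cmod (\<mu> (A i \<inter> E)))) \<le> variation M \<mu> (A i)" for i
      proof -
        have "(\<Sum>E\<in>P. ennreal (cmod (\<mu> (A i \<inter> E)))) = ?S ((\<inter>) (A i) ` P)"
        proof (subst sum.reindex_nontrivial, goal_cases)
          case (2 E F)
          hence "E \<inter> F = {}" using P by (auto simp: partition_on_def disjoint_def)
          hence "A i \<inter> E = {}" using 2 by blast
          thus ?case by (simp add: E0)
        qed (use P in auto)
        also have "\<dots> = ?S ((\<inter>) (A i) ` P - {{}})"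
          using P by (intro sum.mono_neutral_right) (auto simp: E0)
        also have "\<dots> \<le> variation M \<mu> (A i)"
          unfolding variation_def
        proof (rule SUP_upper)
          have "partition_on (A i \<inter> (\<Union>i. A i)) ((\<inter>) (A i) ` P - {{}})"
            using P by (intro partition_on_restrict) simp
          moreover have "A i \<inter> (\<Union>i. A i) = A i" by auto
          ultimately show "(\<inter>) (A i) ` P - {{}} \<in> ?I (A i)" using P A(1) by auto
        qed
        finally show ?thesis .
      qed
      have "?S P \<le> (\<Sum>E\<in>P. \<Sum>i. ennreal (cmod (\<mu> (A i \<inter> E))))" by (intro sum_mono 1)
      also have "\<dots> = (\<Sum>i. \<Sum>E\<in>P. ennreal (cmod (\<mu> (A i \<inter> E))))" by (subst suminf_sum) auto
      also have "\<dots> \<le> (\<Sum>i. variation M \<mu> (A i))" by (intro suminf_le 2) auto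
      finally show "?S P \<le> (\<Sum>i. variation M \<mu> (A i))" .
    qed
  qed (rule V0)
qed (use A sets.sigma_algebra_axioms in auto)

lemma emeasure_positive_part:
  assumes \<nu>: "\<And>A :: nat \<Rightarrow> 'a set. range A \<subseteq> sets M \<Longrightarrow> disjoint_family A \<Longrightarrow>
                 (\<lambda>i. \<nu> (A i)) sums \<nu> (\<Union>i. A i)"
    and A: "A \<in> sets M"
  shows "emeasure (positive_part M \<nu>) A = upper_variation M \<nu> A"
  unfolding positive_part_def
proof (rule emeasure_measure_of_sigma)
  have "(\<lambda>i::nat. \<nu> {}) sums \<nu> {}"
    using \<nu>[of "\<lambda>_. {}"] by (simp add: disjoint_family_on_def)
  hence "summable (\<lambda>i::nat. \<nu> {})" by (rule sums_summable)
  hence E0: "\<nu> {} = 0" by (simp add: summable_const_iff)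
  have "{B \<in> sets M. B = {}} = {{}}" by auto
  hence V0: "upper_variation M \<nu> {} = 0" by (simp add: upper_variation_def E0)
  thus "positive (sets M) (upper_variation M \<nu>)" by (simp add: positive_def)
  have add: "\<nu> (B \<union> C) = \<nu> B + \<nu> C" if "B \<in> sets M" "C \<in> sets M" "B \<inter> C = {}" for B C
  proof -
    have "(\<lambda>i. \<nu> (binaryset B C i)) sums \<nu> (\<Union>i. binaryset B C i)"
      using that by (intro \<nu>) (auto simp: range_binaryset_eq disjoint_family_on_def binaryset_def)
    moreover have "(\<lambda>i. \<nu> (binaryset B C i)) sums (\<nu> B + \<nu> C)"
      by (rule binaryset_sums[of \<nu>]) (rule E0)
    ultimately show ?thesis using UN_binaryset_eq[of B C] sums_unique2 by metis
  qed
  let ?I = "\<lambda>A. {B \<in> sets M. B \<subseteq> A}"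
  let ?p = "\<lambda>B. ennreal (\<nu> B)"
  have ne: "?I A \<noteq> {}" for A by auto
  have upper: "?p B \<le> upper_variation M \<nu> A" if "B \<in> ?I A" for A B
    unfolding upper_variation_def using that by (rule SUP_upper)
  show "countably_additive (sets M) (upper_variation M \<nu>)"
  proof (rule countably_additiveI_super_sub)
    fix A B assume AB: "A \<in> sets M" "B \<in> sets M" "A \<inter> B = {}"
    have "?p P + ?p Q \<le> upper_variation M \<nu> (A \<union> B)" if P: "P \<in> ?I A" and Q: "Q \<in> ?I B" for P Q
    proof -
      consider "\<nu> P \<le> 0" | "\<nu> Q \<le> 0" | "\<nu> P \<ge> 0" "\<nu> Q \<ge> 0" by linarith
      thus ?thesis
      proof cases
        case 1
        thus ?thesis using upper[of Q "A \<union> B"] Q by (auto simp: ennreal_neg)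
      next
        case 2
        thus ?thesis using upper[of P "A \<union> B"] P by (auto simp: ennreal_neg)
      next
        case 3
        have "\<nu> (P \<union> Q) = \<nu> P + \<nu> Q" using P Q AB(3) by (intro add) auto
        moreover have "?p (P \<union> Q) \<le> upper_variation M \<nu> (A \<union> B)" using P Q by (intro upper) auto
        ultimately show ?thesis using 3 by simp
      qed
    qed
    thus "upper_variation M \<nu> A + upper_variation M \<nu> B \<le> upper_variation M \<nu> (A \<union> B)"
      unfolding upper_variation_def[of M \<nu> A] upper_variation_def[of M \<nu> B]
      by (intro SUP_add_SUP_le ne)
  next
    fix A :: "nat \<Rightarrow> 'a set"
    assume A: "range A \<subseteq> sets M" "disjoint_family A"
    show "upper_variation M \<nu> (\<Union>i. A i) \<le> (\<Sum>i. upper_variation M \<nu> (A i))"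
      unfolding upper_variation_def[of M \<nu> "\<Union>i. A i"]
    proof (rule SUP_least)
      fix B assume B: "B \<in> ?I (\<Union>i. A i)"
      have "(\<lambda>i. \<nu> (A i \<inter> B)) sums \<nu> (\<Union>i. A i \<inter> B)"
        using A B by (intro \<nu>) (auto simp: disjoint_family_on_def)
      moreover have "(\<Union>i. A i \<inter> B) = B" using B by auto
      ultimately have "(\<lambda>n. ennreal (\<Sum>i<n. \<nu> (A i \<inter> B))) \<longlonglongrightarrow> ennreal (\<nu> B)"
        by (auto simp: sums_def intro!: tendsto_ennrealI)
      thus "?p B \<le> (\<Sum>i. upper_variation M \<nu> (A i))"
      proof (rule LIMSEQ_le_const2, intro exI allI impI)
        fix n :: nat
        have "ennreal (\<Sum>i<n. \<nu> (A i \<inter> B)) \<le> ennreal (\<Sum>i<n. max 0 (\<nu> (A i \<inter> B)))"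
          by (intro ennreal_leI sum_mono) auto
        also have "\<dots> = (\<Sum>i<n. ennreal (max 0 (\<nu> (A i \<inter> B))))" by (subst sum_ennreal) auto
        also have "\<dots> = (\<Sum>i<n. ?p (A i \<inter> B))" by (simp add: ennreal_max_0)
        also have "\<dots> \<le> (\<Sum>i<n. upper_variation M \<nu> (A i))"
          using A(1) B by (intro sum_mono upper) auto
        also have "\<dots> \<le> (\<Sum>i. upper_variation M \<nu> (A i))" by (rule sum_le_suminf) auto
        finally show "ennreal (\<Sum>i<n. \<nu> (A i \<inter> B)) \<le> \<dots>" .
      qed
    qed
  qed (rule V0)
qed (use A sets.sigma_algebra_axioms in auto)

end

theory Submission
  imports Defs "HOL-Complex_Analysis.Winding_Numbers"
begin

text \<open>
  Write \<open>d\<mu> = h d|\<mu>|\<close> and let \<open>F(z) = \<integral> d\<mu>(\<zeta>) / (\<zeta> - z)\<close>. By a symmetrisation of the double integral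
  for \<open>F(z)\<^sup>2\<close>, which needs that \<open>\<mu>\<close> has no atoms, \<open>F(z)\<^sup>2\<close> is the limit of
  \<open>2 \<integral> C\<^sub>\<epsilon>(\<zeta>) / (\<zeta> - z) d\<mu>(\<zeta>)\<close> as \<open>\<epsilon> \<rightarrow> 0\<close>. By dominated convergence this limit is \<open>0\<close> wherever
  \<open>\<integral> (1 + C\<^sub>*(\<zeta>)) / |\<zeta> - z| d|\<mu>|(\<zeta>)\<close> is finite. Since \<open>1 / |u + iv| \<le> |u|\<^bsup>-1/2\<^esup> |v|\<^bsup>-1/2\<^esup>\<close>, on
  almost every horizontal or vertical line this happens almost everywhere. Integrating \<open>F = 0\<close> along
  the boundary of a rectangle with sides on such lines gives, by Cauchy's formula and Fubini,
  that \<open>\<mu>\<close> vanishes on the rectangle; these rectangles determine \<open>\<mu>\<close>.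
\<close>

section \<open>Boundedness and densities of complex measures\<close>

text \<open>This packages the hypothesis of \<open>emeasure_positive_part\<close>, so that the real
  and imaginary parts of a complex measure and their negatives can be treated alike.\<close>

definition signed_measure :: "'a measure \<Rightarrow> ('a set \<Rightarrow> real) \<Rightarrow> bool" where
  "signed_measure M \<nu> \<longleftrightarrow>
     (\<forall>A :: nat \<Rightarrow> 'a set. range A \<subseteq> sets M \<longrightarrow> disjoint_family A \<longrightarrow>
        (\<lambda>i. \<nu> (A i)) sums \<nu> (\<Union>i. A i))"

lemma signed_measure_sums:
  "signed_measure M \<nu> \<Longrightarrow> range A \<subseteq> sets M \<Longrightarrow> disjoint_family A \<Longrightarrow>
     (\<lambda>i::nat. \<nu> (A i)) sums \<nu> (\<Union>i. A i)"
  unfolding signed_measure_def by blast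

lemma signed_measure_uminus: "signed_measure M \<nu> \<Longrightarrow> signed_measure M (\<lambda>A. - \<nu> A)"
  unfolding signed_measure_def using sums_minus by auto

lemma signed_measure_Re: "complex_measure M \<mu> \<Longrightarrow> signed_measure M (\<lambda>A. Re (\<mu> A))"
  unfolding signed_measure_def complex_measure_def using sums_Re by auto

lemma signed_measure_Im: "complex_measure M \<mu> \<Longrightarrow> signed_measure M (\<lambda>A. Im (\<mu> A))"
  unfolding signed_measure_def complex_measure_def using sums_Im by auto

lemma signed_measure_empty:
  assumes "signed_measure M \<nu>" shows "\<nu> {} = 0"
proof -
  have "(\<lambda>i::nat. \<nu> {}) sums \<nu> {}"
    using signed_measure_sums[OF assms, of "\<lambda>_. {}"] by (simp add: disjoint_family_on_def)
  hence "summable (\<lambda>i::nat. \<nu> {})" by (rule sums_summable)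
  thus ?thesis by (simp add: summable_const_iff)
qed

lemma signed_measure_Un:
  assumes "signed_measure M \<nu>" "A \<in> sets M" "B \<in> sets M" "A \<inter> B = {}"
  shows "\<nu> (A \<union> B) = \<nu> A + \<nu> B"
proof -
  have "(\<lambda>i. \<nu> (binaryset A B i)) sums \<nu> (\<Union>i. binaryset A B i)"
    using assms
    by (intro signed_measure_sums[OF assms(1)])
       (auto simp: range_binaryset_eq disjoint_family_on_def binaryset_def)
  moreover have "(\<lambda>i. \<nu> (binaryset A B i)) sums (\<nu> A + \<nu> B)"
    by (rule binaryset_sums[of \<nu>]) (rule signed_measure_empty[OF assms(1)])
  ultimately show ?thesis using UN_binaryset_eq[of A B] sums_unique2 by metis
qed

lemma signed_measure_Diff:
  assumes "signed_measure M \<nu>" "A \<in> sets M" "B \<in> sets M" "B \<subseteq> A"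
  shows "\<nu> (A - B) = \<nu> A - \<nu> B"
  using signed_measure_Un[OF assms(1,3), of "A - B"] assms by (simp add: Un_absorb1)

lemma emeasure_positive_part_signed:
  "signed_measure M \<nu> \<Longrightarrow> A \<in> sets M \<Longrightarrow> emeasure (positive_part M \<nu>) A = upper_variation M \<nu> A"
  by (rule emeasure_positive_part) (auto intro: signed_measure_sums)

lemma upper_variation_ge:
  "B \<in> sets M \<Longrightarrow> B \<subseteq> A \<Longrightarrow> ennreal (\<nu> B) \<le> upper_variation M \<nu> A"
  unfolding upper_variation_def by (rule SUP_upper) simp

text \<open>
  A set of infinite upper variation contains another one such that the difference has
  \<open>\<nu>\<close>-measure more than \<open>1\<close> in modulus; iterating this contradicts countable additivity.
\<close>

lemma finite_measure_positive_part:
  assumes \<nu>: "signed_measure M \<nu>"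
  shows "finite_measure (positive_part M \<nu>)"
proof (rule finite_measureI, rule notI)
  let ?p = "upper_variation M \<nu>"
  define Q where "Q A \<longleftrightarrow> A \<in> sets M \<and> ?p A = \<infinity>" for A
  assume "emeasure (positive_part M \<nu>) (space (positive_part M \<nu>)) = \<infinity>"
  hence Q0: "Q (space M)" using emeasure_positive_part_signed[OF \<nu>] by (simp add: Q_def)
  have step: "\<exists>B. Q B \<and> B \<subseteq> A \<and> \<bar>\<nu> (A - B)\<bar> > 1" if "Q A" for A
  proof -
    have A: "A \<in> sets M" "?p A = \<infinity>" using that by (auto simp: Q_def)
    \<comment> \<open>The threshold makes both \<nu>(B) and |\<nu>(A - B)| exceed 1, so whichever of
      \<open>B\<close> and \<open>A - B\<close> has infinite upper variation can be kept.\<close>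
    have "ennreal (\<bar>\<nu> A\<bar> + 1) < ?p A" using A(2) by simp
    then obtain B where B: "B \<in> sets M" "B \<subseteq> A" "ennreal (\<bar>\<nu> A\<bar> + 1) < ennreal (\<nu> B)"
      unfolding upper_variation_def less_SUP_iff by auto
    from B(3) have gt: "\<bar>\<nu> A\<bar> + 1 < \<nu> B"
      by (subst (asm) ennreal_less_iff) auto
    have D: "\<nu> (A - B) = \<nu> A - \<nu> B" by (rule signed_measure_Diff[OF \<nu> A(1) B(1,2)])
    have "emeasure (positive_part M \<nu>) B + emeasure (positive_part M \<nu>) (A - B)
            = emeasure (positive_part M \<nu>) A"
      using A(1) B by (subst plus_emeasure) (auto simp: Un_absorb1)
    hence "?p B + ?p (A - B) = \<infinity>"
      using A B(1) by (simp add: emeasure_positive_part_signed[OF \<nu>])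
    then consider "?p B = \<infinity>" | "?p (A - B) = \<infinity>" by auto
    thus ?thesis
    proof cases
      case 1
      have "\<bar>\<nu> (A - B)\<bar> > 1" using D gt by linarith
      thus ?thesis using 1 B by (auto simp: Q_def)
    next
      case 2
      have "A - (A - B) = B" using B(2) by blast
      hence "\<bar>\<nu> (A - (A - B))\<bar> > 1" using gt by auto
      moreover have "Q (A - B)" using 2 A B by (auto simp: Q_def)
      ultimately show ?thesis by blast
    qed
  qed
  obtain E where E: "\<And>n. Q (E n)" "\<And>n. E (Suc n) \<subseteq> E n \<and> \<bar>\<nu> (E n - E (Suc n))\<bar> > 1"
    using dependent_nat_choice[of "\<lambda>_. Q" "\<lambda>_ A B. B \<subseteq> A \<and> \<bar>\<nu> (A - B)\<bar> > 1"] Q0 step by metis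
  have anti: "E n \<subseteq> E m" if "m \<le> n" for m n
    using lift_Suc_antimono_le[of E m n] that E(2) by blast
  have "disjoint_family (\<lambda>n. E n - E (Suc n))"
    unfolding disjoint_family_on_def
  proof (intro ballI impI)
    fix m n :: nat assume "m \<noteq> n"
    then consider "Suc m \<le> n" | "Suc n \<le> m" by linarith
    thus "(E m - E (Suc m)) \<inter> (E n - E (Suc n)) = {}"
      by cases (use anti in blast)+
  qed
  hence "(\<lambda>n. \<nu> (E n - E (Suc n))) sums \<nu> (\<Union>n. E n - E (Suc n))"
    using E(1) by (intro signed_measure_sums[OF \<nu>]) (auto simp: Q_def)
  hence "(\<lambda>n. \<nu> (E n - E (Suc n))) \<longlonglongrightarrow> 0" by (intro summable_LIMSEQ_zero sums_summable)
  hence "\<forall>\<^sub>F n in sequentially. \<bar>\<nu> (E n - E (Suc n))\<bar> < 1"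
    using order_tendstoD(2)[OF tendsto_rabs_zero, of _ sequentially 1] by simp
  then obtain n where "\<bar>\<nu> (E n - E (Suc n))\<bar> < 1" by (auto simp: eventually_sequentially)
  thus False using E(2)[of n] by linarith
qed

text \<open>For B \<subseteq> A, \<nu>(B) = \<nu>(A) - \<nu>(A - B) is at most \<nu>(A) plus the
  negative part of A. The supremum over B gives one inequality, and the same argument for -\<nu>
  gives the other.\<close>

lemma positive_part_diff:
  assumes \<nu>: "signed_measure M \<nu>" and A: "A \<in> sets M"
  shows "\<nu> A = measure (positive_part M \<nu>) A - measure (positive_part M (\<lambda>A. - \<nu> A)) A"
proof -
  have *: "measure (positive_part M \<nu>) A \<le> \<nu> A + measure (positive_part M (\<lambda>A. - \<nu> A)) A"
    if \<nu>: "signed_measure M \<nu>" for \<nu>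
  proof -
    note \<nu>' = signed_measure_uminus[OF \<nu>]
    interpret P: finite_measure "positive_part M \<nu>" by (rule finite_measure_positive_part[OF \<nu>])
    interpret N: finite_measure "positive_part M (\<lambda>A. - \<nu> A)"
      by (rule finite_measure_positive_part[OF \<nu>'])
    have le: "\<nu> B \<le> \<nu> A + measure (positive_part M (\<lambda>A. - \<nu> A)) A" if B: "B \<in> sets M" "B \<subseteq> A" for B
    proof -
      have "ennreal (- \<nu> (A - B)) \<le> ennreal (measure (positive_part M (\<lambda>A. - \<nu> A)) A)"
        using upper_variation_ge[of "A - B" M A "\<lambda>A. - \<nu> A"] A B
        by (simp add: N.emeasure_eq_measure[symmetric] emeasure_positive_part_signed[OF \<nu>'])
      hence "- \<nu> (A - B) \<le> measure (positive_part M (\<lambda>A. - \<nu> A)) A"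
        by (simp add: ennreal_le_iff)
      thus ?thesis using signed_measure_Diff[OF \<nu> A B] by linarith
    qed
    have "upper_variation M \<nu> A \<le> ennreal (\<nu> A + measure (positive_part M (\<lambda>A. - \<nu> A)) A)"
      unfolding upper_variation_def by (intro SUP_least ennreal_leI le) auto
    \<comment> \<open>\<open>ennreal\<close> sends negative reals to 0, so the real inequality can
      be recovered only once its right side is known to be nonnegative.\<close>
    moreover have "0 \<le> \<nu> A + measure (positive_part M (\<lambda>A. - \<nu> A)) A"
      using le[of "{}"] by (simp add: signed_measure_empty[OF \<nu>])
    ultimately show ?thesis
      by (simp add: emeasure_positive_part_signed[OF \<nu> A, symmetric] P.emeasure_eq_measure ennreal_le_iff)
  qed
  show ?thesis using *[OF \<nu>] *[OF signed_measure_uminus[OF \<nu>]] by simp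
qed

section \<open>Comparison of the Jordan parts with the total variation\<close>

text \<open>The one-block partition of each B \<subseteq> A already gives \<nu>(B) \<le> |\<mu>|(B).
  The four Jordan parts of \<mu> are thereby dominated by |\<mu>|.\<close>

lemma emeasure_positive_part_le_total_variation:
  assumes \<mu>: "complex_measure M \<mu>" and \<nu>: "signed_measure M \<nu>"
    and le: "\<And>B. B \<in> sets M \<Longrightarrow> \<nu> B \<le> cmod (\<mu> B)" and A: "A \<in> sets M"
  shows "emeasure (positive_part M \<nu>) A \<le> emeasure (total_variation M \<mu>) A"
  unfolding emeasure_positive_part_signed[OF \<nu> A] upper_variation_def
proof (rule SUP_least)
  fix B assume B: "B \<in> {B \<in> sets M. B \<subseteq> A}"
  have "ennreal (\<nu> B) \<le> emeasure (total_variation M \<mu>) B"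
  \<comment> \<open>Blocks of a partition are nonempty, so \<open>{B}\<close> is a partition of
    \<open>B\<close> only for nonempty \<open>B\<close>.\<close>
  proof (cases "B = {}")
    case True
    thus ?thesis by (simp add: signed_measure_empty[OF \<nu>])
  next
    case False
    have "ennreal (\<nu> B) \<le> (\<Sum>E\<in>{B}. ennreal (cmod (\<mu> E)))" using le B by (simp add: ennreal_leI)
    also have "\<dots> \<le> variation M \<mu> B"
      unfolding variation_def
      by (rule SUP_upper[of "{B}"]) (use False B in \<open>auto simp: partition_on_space\<close>)
    finally show ?thesis using B by (simp add: emeasure_total_variation[OF \<mu>])
  qed
  also have "\<dots> \<le> emeasure (total_variation M \<mu>) A"
    using A B by (intro emeasure_mono) auto
  finally show "ennreal (\<nu> B) \<le> emeasure (total_variation M \<mu>) A" .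
qed

lemma signed_measure_abs_le:
  assumes \<nu>: "signed_measure M \<nu>" and A: "A \<in> sets M"
  shows "\<bar>\<nu> A\<bar> \<le> measure (positive_part M \<nu>) A + measure (positive_part M (\<lambda>A. - \<nu> A)) A"
  by (subst positive_part_diff[OF \<nu> A])
     (smt (verit, best) measure_nonneg)

text \<open>On each block |\<mu>(E)| is at most the sum of the four Jordan parts. These are
  additive, so one bound serves all partitions; as it is finite, so is |\<mu>|.\<close>

lemma emeasure_total_variation_le:
  assumes \<mu>: "complex_measure M \<mu>" and A: "A \<in> sets M"
  defines "P \<equiv> \<lambda>\<nu>. measure (positive_part M \<nu>)"
  shows "emeasure (total_variation M \<mu>) A \<le>
     ennreal (P (\<lambda>A. Re (\<mu> A)) A + P (\<lambda>A. - Re (\<mu> A)) A + P (\<lambda>A. Im (\<mu> A)) A + P (\<lambda>A. - Im (\<mu> A)) A)"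
  unfolding emeasure_total_variation[OF \<mu> A] variation_def
proof (rule SUP_least)
  note re = signed_measure_Re[OF \<mu>] and im = signed_measure_Im[OF \<mu>]
  let ?S = "\<lambda>A. P (\<lambda>A. Re (\<mu> A)) A + P (\<lambda>A. - Re (\<mu> A)) A + P (\<lambda>A. Im (\<mu> A)) A + P (\<lambda>A. - Im (\<mu> A)) A"
  fix Q assume Q: "Q \<in> {P. finite P \<and> partition_on A P \<and> P \<subseteq> sets M}"
  have "(\<Sum>E\<in>Q. ennreal (cmod (\<mu> E))) \<le> (\<Sum>E\<in>Q. ennreal (?S E))"
  proof (intro sum_mono ennreal_leI)
    fix E assume "E \<in> Q"
    hence E: "E \<in> sets M" using Q by auto
    show "cmod (\<mu> E) \<le> ?S E"
      using cmod_le[of "\<mu> E"] signed_measure_abs_le[OF re E] signed_measure_abs_le[OF im E]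
      unfolding P_def by linarith
  qed
  also have "\<dots> = ennreal (\<Sum>E\<in>Q. ?S E)"
    by (rule sum_ennreal) (simp add: P_def)
  also have "(\<Sum>E\<in>Q. ?S E) = ?S A"
  proof -
    have "P \<nu> A = (\<Sum>E\<in>Q. P \<nu> E)" if "signed_measure M \<nu>" for \<nu>
    proof -
      interpret finite_measure "positive_part M \<nu>" by (rule finite_measure_positive_part[OF that])
      have "P \<nu> (\<Union>E\<in>Q. E) = (\<Sum>E\<in>Q. P \<nu> E)"
        unfolding P_def using Q
        by (intro finite_measure_finite_Union) (auto simp: partition_on_def disjoint_family_on_def disjoint_def)
      thus ?thesis using Q by (simp add: partition_on_def)
    qed
    thus ?thesis
      using re im signed_measure_uminus[OF re] signed_measure_uminus[OF im]
      by (simp add: sum.distrib)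
  qed
  finally show "(\<Sum>E\<in>Q. ennreal (cmod (\<mu> E))) \<le> ennreal (?S A)" .
qed

lemma finite_measure_total_variation:
  assumes "complex_measure M \<mu>"
  shows "finite_measure (total_variation M \<mu>)"
  by (rule finite_measureI)
     (use emeasure_total_variation_le[OF assms, of "space M"] in \<open>auto simp: top_unique\<close>)

text \<open>Radon-Nikodym gives an extended real density. Domination by T makes it at most 1 almost
  everywhere, and truncation at 1 then makes it real and bounded at every point.\<close>

lemma finite_measure_density_le_1:
  assumes "finite_measure T" and sets: "sets N = sets T"
    and le: "\<And>A. A \<in> sets T \<Longrightarrow> emeasure N A \<le> emeasure T A"
  obtains g :: "'a \<Rightarrow> real" where "g \<in> borel_measurable T" "\<And>x. 0 \<le> g x" "\<And>x. g x \<le> 1"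
    "N = density T (\<lambda>x. ennreal (g x))"
proof -
  interpret T: finite_measure T by fact
  have "finite_measure N"
    using le[OF sets.top] sets_eq_imp_space_eq[OF sets]
    by (intro finite_measureI) (auto simp: top_unique)
  moreover have "absolutely_continuous T N"
    unfolding absolutely_continuous_def null_sets_def
    using le sets by clarsimp (metis le_zero_eq)
  ultimately obtain f where f[measurable]: "f \<in> borel_measurable T" and dens: "density T f = N"
    using T.Radon_Nikodym_finite_measure[of N] sets by auto
  have "AE x in T. f x \<le> 1"
  proof -
    let ?A = "{x \<in> space T. f x > 1}"
    let ?I = "\<lambda>x. indicator ?A x :: ennreal"
    have A: "?A \<in> sets T" by measurable
    \<comment> \<open>This integral of f - 1 over {f > 1} equals N(A) - T(A), which is 0 because N
      \<le> T and subtraction in \<open>ennreal\<close> is truncated.\<close>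
    have "(\<integral>\<^sup>+x. f x * ?I x - ?I x \<partial>T) = (\<integral>\<^sup>+x. f x * ?I x \<partial>T) - (\<integral>\<^sup>+x. ?I x \<partial>T)"
    proof (rule nn_integral_diff)
      show "(\<integral>\<^sup>+x. ?I x \<partial>T) \<noteq> \<infinity>" using A by simp
    qed (measurable, auto simp: indicator_def less_imp_le)
    also have "(\<integral>\<^sup>+x. f x * ?I x \<partial>T) = emeasure N ?A"
      unfolding dens[symmetric] by (rule emeasure_density[symmetric]) measurable
    also have "\<dots> - (\<integral>\<^sup>+x. ?I x \<partial>T) = 0"
      using le[OF A] A by (auto simp: diff_eq_0_iff_ennreal less_top[symmetric] top_unique)
    finally have "AE x in T. f x * ?I x - ?I x = 0"
      by (subst (asm) nn_integral_0_iff_AE) auto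
    moreover have "AE x in T. x \<in> space T" by simp
    ultimately show ?thesis
    proof eventually_elim
      case (elim x)
      thus ?case by (cases "1 < f x") (auto simp: diff_eq_0_iff_ennreal)
    qed
  qed
  hence AE: "AE x in T. f x = ennreal (enn2real (min 1 (f x)))"
    by eventually_elim (auto simp: min_def ennreal_enn2real_if top_unique)
  show thesis
  proof (rule that[of "\<lambda>x. enn2real (min 1 (f x))"])
    show "enn2real (min 1 (f x)) \<le> 1" for x
      using enn2real_mono[of "min 1 (f x)" 1] by simp
    show "N = density T (\<lambda>x. ennreal (enn2real (min 1 (f x))))"
      unfolding dens[symmetric] by (rule density_cong[OF _ _ AE]) measurable
    show "(\<lambda>x. enn2real (min 1 (f x))) \<in> borel_measurable T"
      by (intro borel_measurable_enn2real borel_measurable_min f measurable_const) simp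
  qed simp
qed

text \<open>In fact \<open>|h| = 1\<close> almost everywhere, but the crude bound suffices.\<close>

lemma complex_measure_density:
  fixes M :: "'a measure" and \<mu> :: "'a set \<Rightarrow> complex"
  assumes \<mu>: "complex_measure M \<mu>"
  defines "T \<equiv> total_variation M \<mu>"
  obtains h :: "'a \<Rightarrow> complex"
    where "h \<in> borel_measurable M" "\<And>x. cmod (h x) \<le> 4"
      "\<And>f. integrable T f \<Longrightarrow> complex_measure_integral M \<mu> f = (LINT x|T. h x * f x)"
      "\<And>A. A \<in> sets M \<Longrightarrow> \<mu> A = (LINT x|T. h x * indicator A x)"
proof -
  note re = signed_measure_Re[OF \<mu>] and im = signed_measure_Im[OF \<mu>]
  interpret T: finite_measure T unfolding T_def by (rule finite_measure_total_variation[OF \<mu>])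
  have ex: thesis'
    if \<nu>: "signed_measure M \<nu>" "\<And>B. \<nu> B \<le> cmod (\<mu> B)"
      and "\<And>g. g \<in> borel_measurable T \<Longrightarrow> (\<And>x. 0 \<le> g x) \<Longrightarrow> (\<And>x. g x \<le> 1) \<Longrightarrow>
              positive_part M \<nu> = density T (\<lambda>x. ennreal (g x)) \<Longrightarrow> thesis'" for \<nu> thesis'
  proof (rule finite_measure_density_le_1[OF T.finite_measure_axioms, of "positive_part M \<nu>"])
    show "emeasure (positive_part M \<nu>) A \<le> emeasure T A" if "A \<in> sets T" for A
      using that unfolding T_def
      by (intro emeasure_positive_part_le_total_variation[OF \<mu> \<nu>(1)] \<nu>(2)) simp
  qed (use that(3) in \<open>simp_all add: T_def\<close>)
  have cm: "- Re z \<le> cmod z" "- Im z \<le> cmod z" "Re z \<le> cmod z" "Im z \<le> cmod z" for z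
    using abs_Re_le_cmod[of z] abs_Im_le_cmod[of z] by linarith+
  obtain g1 where [measurable]: "g1 \<in> borel_measurable T" and b1: "\<And>x. 0 \<le> g1 x" "\<And>x. g1 x \<le> 1"
    and d1: "positive_part M (\<lambda>A. Re (\<mu> A)) = density T (\<lambda>x. ennreal (g1 x))"
    by (rule ex[OF re cm(3)]) (rule that; assumption)
  obtain g2 where [measurable]: "g2 \<in> borel_measurable T" and b2: "\<And>x. 0 \<le> g2 x" "\<And>x. g2 x \<le> 1"
    and d2: "positive_part M (\<lambda>A. - Re (\<mu> A)) = density T (\<lambda>x. ennreal (g2 x))"
    by (rule ex[OF signed_measure_uminus[OF re] cm(1)]) (rule that; assumption)
  obtain g3 where [measurable]: "g3 \<in> borel_measurable T" and b3: "\<And>x. 0 \<le> g3 x" "\<And>x. g3 x \<le> 1"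
    and d3: "positive_part M (\<lambda>A. Im (\<mu> A)) = density T (\<lambda>x. ennreal (g3 x))"
    by (rule ex[OF im cm(4)]) (rule that; assumption)
  obtain g4 where [measurable]: "g4 \<in> borel_measurable T" and b4: "\<And>x. 0 \<le> g4 x" "\<And>x. g4 x \<le> 1"
    and d4: "positive_part M (\<lambda>A. - Im (\<mu> A)) = density T (\<lambda>x. ennreal (g4 x))"
    by (rule ex[OF signed_measure_uminus[OF im] cm(2)]) (rule that; assumption)
  note b = b1 b2 b3 b4 and d = d1 d2 d3 d4
  \<comment> \<open>The densities of the four Jordan parts are combined with the coefficients 1, -1,
    \<i>, -\<i> of \<open>complex_measure_integral\<close>.\<close>
  define h where "h x = complex_of_real (g1 x - g2 x) + \<i> * complex_of_real (g3 x - g4 x)" for x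
  have sets[simp]: "sets T = sets M" by (simp add: T_def)
  have *: "complex_measure_integral M \<mu> f = (LINT x|T. h x * f x)" if f: "integrable T f" for f
  proof -
    have [measurable]: "f \<in> borel_measurable T" using f by simp
    have int: "integrable T (\<lambda>x. g x *\<^sub>R f x)"
      if "g \<in> borel_measurable T" "\<And>x. 0 \<le> g x" "\<And>x. g x \<le> 1" for g
      by (rule Bochner_Integration.integrable_bound[OF f])
         (use that in \<open>auto intro!: AE_I2 mult_left_le_one_le\<close>)
    note ints = int[of g1] int[of g2] int[of g3] int[of g4]
    have "(LINT x|T. h x * f x) =
       (LINT x|T. (g1 x *\<^sub>R f x - g2 x *\<^sub>R f x) + \<i> * (g3 x *\<^sub>R f x - g4 x *\<^sub>R f x))"
      by (intro Bochner_Integration.integral_cong refl)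
         (simp add: h_def scaleR_conv_of_real algebra_simps)
    also have "\<dots> = (LINT x|T. g1 x *\<^sub>R f x) - (LINT x|T. g2 x *\<^sub>R f x)
                  + \<i> * ((LINT x|T. g3 x *\<^sub>R f x) - (LINT x|T. g4 x *\<^sub>R f x))"
      using ints b by simp
    finally show ?thesis
      unfolding complex_measure_integral_def d using b by (simp add: integral_density)
  qed
  show thesis
  proof (rule that[OF _ _ *])
    show "h \<in> borel_measurable M"
      unfolding measurable_cong_sets[OF sets[symmetric] refl] h_def by measurable
    show "cmod (h x) \<le> 4" for x
      using cmod_le[of "h x"] b[of x] by (simp add: h_def)
    fix A assume A: "A \<in> sets M"
    have int: "integrable T (indicator A :: _ \<Rightarrow> complex)"
      using A by (intro T.integrable_const_bound[of _ 1] borel_measurable_indicator) (auto simp: indicator_def)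
    have "(LINT x|positive_part M \<nu>. indicator A x :: complex) = measure (positive_part M \<nu>) A" for \<nu>
    proof -
      have "(LINT x|positive_part M \<nu>. indicator A x :: complex)
              = (LINT x|positive_part M \<nu>. complex_of_real (indicator A x))"
        by (intro Bochner_Integration.integral_cong) (auto simp: indicator_def)
      thus ?thesis using A sets.sets_into_space[OF A] by (simp add: Int_absorb2)
    qed
    hence "complex_measure_integral M \<mu> (indicator A) = \<mu> A"
      unfolding complex_measure_integral_def
      using positive_part_diff[OF re A] positive_part_diff[OF im A]
      by (simp add: complex_eq_iff)
    thus "\<mu> A = (LINT x|T. h x * indicator A x)" using *[OF int] by simp
  qed
qed


section \<open>The square of the Cauchy transform\<close>

lemma integrable_pair_mult:
  fixes f :: "'a \<Rightarrow> complex" and g :: "'b \<Rightarrow> complex"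
  assumes "sigma_finite_measure M" "sigma_finite_measure N" "integrable M f" "integrable N g"
  shows "integrable (M \<Otimes>\<^sub>M N) (\<lambda>(x, y). f x * g y)"
proof -
  interpret M: sigma_finite_measure M by fact
  interpret N: sigma_finite_measure N by fact
  interpret pair_sigma_finite M N ..
  have [measurable]: "f \<in> borel_measurable M" "g \<in> borel_measurable N" using assms by auto
  show ?thesis
    by (rule Fubini_integrable) (use assms in \<open>auto simp: norm_mult\<close>)
qed

text \<open>The measure h dT replaces \<mu>, with T in the role of |\<mu>|, so that the analytic
  part deals with integrals of functions instead of set functions.\<close>

locale bounded_density = finite_measure T for T :: "complex measure" +
  fixes h :: "complex \<Rightarrow> complex" and C :: real
  assumes sets_T [measurable_cong, simp]: "sets T = sets borel"
    and h_measurable [measurable]: "h \<in> borel_measurable borel"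
    and h_bounded: "\<And>z. cmod (h z) \<le> C"
    and no_atoms: "\<And>z. emeasure T {z} = 0"
begin

lemma AE_neq: "AE \<zeta> in T. \<zeta> \<noteq> z"
  by (rule AE_I[of _ _ "{z}"]) (auto simp: no_atoms)

lemma C_nonneg: "0 \<le> C"
  using h_bounded[of 0] norm_ge_zero order_trans by blast

text \<open>The integrand is kept as \<open>h\<close> times the truncated kernel, the shape that
  \<open>complex_measure_density\<close> delivers.\<close>

definition trunc :: "real \<Rightarrow> complex \<Rightarrow> complex" where
  "trunc \<epsilon> z = (LINT \<zeta>|T. h \<zeta> * (indicator {\<zeta>. cmod (\<zeta> - z) > \<epsilon>} \<zeta> *\<^sub>R (1 / (\<zeta> - z))))"

lemma trunc_measurable [measurable]: "trunc \<epsilon> \<in> borel_measurable borel"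
proof -
  have "(\<lambda>(z, \<zeta>). h \<zeta> * (indicator {p. cmod (snd p - fst p) > \<epsilon>} (z, \<zeta>) *\<^sub>R (1 / (\<zeta> - z))))
          \<in> borel_measurable (borel \<Otimes>\<^sub>M T)"
    by measurable
  from borel_measurable_lebesgue_integral[OF this] show ?thesis
    by (simp add: trunc_def[abs_def] indicator_def)
qed

text \<open>
  The identity \<open>1 / ((\<zeta> - z) (\<omega> - z)) = 1 / ((\<zeta> - z) (\<omega> - \<zeta>)) + 1 / ((\<omega> - z) (\<zeta> - \<omega>))\<close>, integrated
  over \<open>\<bar>\<zeta> - \<omega>\<bar> > \<epsilon>\<close>, gives \<open>F(z)\<^sup>2 = 2 lim \<integral> C\<^sub>\<epsilon>(\<zeta>) / (\<zeta> - z) d\<mu>(\<zeta>)\<close> for the Cauchy transform \<open>F\<close>.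
\<close>

lemma cauchy_transform_eq_0:
  assumes D[measurable]: "D \<in> borel_measurable borel"
    and D_ge: "\<And>\<epsilon> \<zeta>. \<epsilon> > 0 \<Longrightarrow> ennreal (cmod (trunc \<epsilon> \<zeta>)) \<le> D \<zeta>"
    and lim: "AE \<zeta> in T. ((\<lambda>\<epsilon>. trunc \<epsilon> \<zeta>) \<longlongrightarrow> 0) (at_right 0)"
    and fin: "(\<integral>\<^sup>+\<zeta>. (1 + D \<zeta>) * ennreal (1 / cmod (\<zeta> - z)) \<partial>T) < \<infinity>"
  shows "(LINT \<zeta>|T. h \<zeta> / (\<zeta> - z)) = 0"
proof -
  interpret P: pair_sigma_finite T T ..
  define k where "k \<zeta> = h \<zeta> / (\<zeta> - z)" for \<zeta>
  have [measurable]: "k \<in> borel_measurable borel" unfolding k_def by measurable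
  have k_le: "cmod (k \<zeta>) \<le> C * (1 / cmod (\<zeta> - z))" for \<zeta>
    using h_bounded[of \<zeta>] by (simp add: k_def norm_divide divide_right_mono)
  \<comment> \<open>The summand 1 in the weight \<open>1 + D\<close> makes the Cauchy kernel at
    \<open>z\<close> integrable, and hence \<open>k\<close>.\<close>
  have "integrable T (\<lambda>\<zeta>. 1 / (\<zeta> - z))"
  proof (rule integrableI_bounded)
    have "(\<integral>\<^sup>+\<zeta>. ennreal (norm (1 / (\<zeta> - z))) \<partial>T) \<le> (\<integral>\<^sup>+\<zeta>. (1 + D \<zeta>) * ennreal (1 / cmod (\<zeta> - z)) \<partial>T)"
      by (intro nn_integral_mono) (auto simp: norm_divide distrib_right)
    thus "(\<integral>\<^sup>+\<zeta>. ennreal (norm (1 / (\<zeta> - z))) \<partial>T) < \<infinity>" using fin by (rule le_less_trans)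
  qed measurable
  hence "integrable T (\<lambda>\<zeta>. C *\<^sub>R (1 / (\<zeta> - z)))" by (rule integrable_scaleR_right)
  hence ik: "integrable T k"
    by (rule Bochner_Integration.integrable_bound)
       (use k_le C_nonneg in \<open>auto simp: norm_divide\<close>)
  \<comment> \<open>The integral of \<open>G\<close> over the product space is F(z) squared.\<close>
  define G where "G = (\<lambda>(\<zeta>, \<omega>). k \<zeta> * k \<omega>)"
  have iG: "integrable (T \<Otimes>\<^sub>M T) G"
    unfolding G_def by (rule integrable_pair_mult) (auto intro: ik sigma_finite_measure_axioms)
  have [measurable]: "G \<in> borel_measurable (T \<Otimes>\<^sub>M T)" using iG by auto
  have intG: "integral\<^sup>L (T \<Otimes>\<^sub>M T) G = integral\<^sup>L T k * integral\<^sup>L T k"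
    using P.integral_fst'[OF iG] by (simp add: G_def)
  \<comment> \<open>Dominated convergence needs a sequence in place of the continuous parameter
    \<epsilon>.\<close>
  define e where "e n = 1 / real (Suc n)" for n
  have e_pos: "e n > 0" for n by (simp add: e_def)
  have e_lim: "e \<longlonglongrightarrow> 0" unfolding e_def by (rule LIMSEQ_Suc) (rule lim_1_over_n)
  define X where "X n = {p :: complex \<times> complex. cmod (snd p - fst p) > e n}" for n
  have [measurable]: "X n \<in> sets (borel \<Otimes>\<^sub>M borel)" for n
  proof -
    have "{p \<in> space (borel \<Otimes>\<^sub>M borel). cmod (snd p - fst p) > e n} \<in> sets (borel \<Otimes>\<^sub>M borel)"
      by measurable
    thus ?thesis by (simp add: X_def space_pair_measure)
  qed
  define J where "J n = (\<lambda>(\<zeta>, \<omega>). indicator (X n) (\<zeta>, \<omega>) *\<^sub>R (k \<zeta> * h \<omega> / (\<omega> - \<zeta>)))" for n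
  have [measurable]: "J n \<in> borel_measurable (T \<Otimes>\<^sub>M T)" for n unfolding J_def by measurable
  \<comment> \<open>Each slice of the diagonal is a single point, so the absence of atoms makes the
    diagonal null. Off it the partial fractions are valid and the sets \<open>X n\<close> exhaust
    the product.\<close>
  have AE_off: "AE p in T \<Otimes>\<^sub>M T. fst p \<noteq> snd p \<and> fst p \<noteq> z \<and> snd p \<noteq> z"
  proof (rule P.AE_pair_measure)
    show "AE x in T. AE y in T. fst (x, y) \<noteq> snd (x, y) \<and> fst (x, y) \<noteq> z \<and> snd (x, y) \<noteq> z"
      using AE_neq[of z]
    proof eventually_elim
      case (elim x)
      show ?case using AE_neq[of x] AE_neq[of z] by eventually_elim (use elim in auto)
    qed
  qed measurable
  \<comment> \<open>On \<open>X n\<close> the factor h(\<omega>) / (\<omega> - \<zeta>) is at most C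
    / e n in modulus, so a constant multiple of the integrable \<open>k\<close> dominates.\<close>
  have iJ: "integrable (T \<Otimes>\<^sub>M T) (J n)" for n
  proof (rule Bochner_Integration.integrable_bound)
    show "integrable (T \<Otimes>\<^sub>M T) (\<lambda>(\<zeta>, \<omega>). k \<zeta> * of_real (C / e n))"
      by (rule integrable_pair_mult) (auto intro: ik sigma_finite_measure_axioms)
    show "AE p in T \<Otimes>\<^sub>M T. norm (J n p) \<le> norm (case p of (\<zeta>, \<omega>) \<Rightarrow> k \<zeta> * of_real (C / e n))"
    proof (rule AE_I2, clarify)
      fix \<zeta> \<omega>
      show "norm (J n (\<zeta>, \<omega>)) \<le> norm (k \<zeta> * complex_of_real (C / e n))"
      proof (cases "(\<zeta>, \<omega>) \<in> X n")
        case True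
        hence "cmod (h \<omega>) / cmod (\<omega> - \<zeta>) \<le> C / e n"
          using h_bounded[of \<omega>] e_pos[of n] C_nonneg by (intro frac_le) (auto simp: X_def)
        hence "cmod (k \<zeta>) * (cmod (h \<omega>) / cmod (\<omega> - \<zeta>)) \<le> cmod (k \<zeta>) * (C / e n)"
          by (intro mult_left_mono) auto
        thus ?thesis using True C_nonneg e_pos[of n]
          by (simp add: J_def norm_mult norm_divide abs_of_pos)
      qed (simp add: J_def)
    qed
  qed measurable
  have iJ': "integrable (T \<Otimes>\<^sub>M T) (\<lambda>(\<zeta>, \<omega>). J n (\<omega>, \<zeta>))" for n
    by (rule P.integrable_product_swap[OF iJ])
  have intJ: "integral\<^sup>L (T \<Otimes>\<^sub>M T) (J n) = (LINT \<zeta>|T. k \<zeta> * trunc (e n) \<zeta>)" for n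
  proof -
    have "(LINT \<omega>|T. J n (\<zeta>, \<omega>)) = k \<zeta> * trunc (e n) \<zeta>" for \<zeta>
      unfolding trunc_def integral_mult_right_zero[symmetric]
      by (intro Bochner_Integration.integral_cong) (auto simp: J_def X_def indicator_def)
    thus ?thesis using P.integral_fst'[OF iJ[of n]] by simp
  qed
  \<comment> \<open>The second partial fraction is \<open>J n\<close> with its variables exchanged.
    Both have the same integral, which explains the factor 2.\<close>
  have split: "(LINT p|(T \<Otimes>\<^sub>M T). indicator (X n) p *\<^sub>R G p) = 2 * (LINT \<zeta>|T. k \<zeta> * trunc (e n) \<zeta>)" for n
  proof -
    have "(LINT p|(T \<Otimes>\<^sub>M T). indicator (X n) p *\<^sub>R G p)
            = (LINT p|(T \<Otimes>\<^sub>M T). J n p + (case p of (\<zeta>, \<omega>) \<Rightarrow> J n (\<omega>, \<zeta>)))"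
    proof (rule integral_cong_AE)
      show "AE p in T \<Otimes>\<^sub>M T. indicator (X n) p *\<^sub>R G p = J n p + (case p of (\<zeta>, \<omega>) \<Rightarrow> J n (\<omega>, \<zeta>))"
        using AE_off
      proof eventually_elim
        case (elim p)
        obtain \<zeta> \<omega> where p: "p = (\<zeta>, \<omega>)" by (cases p)
        have sym: "(\<omega>, \<zeta>) \<in> X n \<longleftrightarrow> (\<zeta>, \<omega>) \<in> X n" by (simp add: X_def norm_minus_commute)
        have ne: "\<zeta> - z \<noteq> 0" "\<omega> - z \<noteq> 0" "\<omega> - \<zeta> \<noteq> 0" "\<zeta> - \<omega> \<noteq> 0" using elim p by auto
        have "k \<zeta> * k \<omega> = k \<zeta> * h \<omega> / (\<omega> - \<zeta>) + k \<omega> * h \<zeta> / (\<zeta> - \<omega>)"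
          unfolding k_def using ne by (simp add: divide_simps) (simp add: algebra_simps)
        thus ?case unfolding p G_def J_def using sym by (auto simp: indicator_def)
      qed
    qed measurable
    also have "\<dots> = integral\<^sup>L (T \<Otimes>\<^sub>M T) (J n) + (LINT p|(T \<Otimes>\<^sub>M T). (case p of (\<zeta>, \<omega>) \<Rightarrow> J n (\<omega>, \<zeta>)))"
      by (rule Bochner_Integration.integral_add[OF iJ iJ'])
    also have "\<dots> = 2 * integral\<^sup>L (T \<Otimes>\<^sub>M T) (J n)"
      by (subst P.integral_product_swap) auto
    finally show ?thesis unfolding intJ .
  qed
  \<comment> \<open>The truncation is removed: every pair off the diagonal eventually lies in
    \<open>X n\<close>, and |G| is an integrable majorant.\<close>
  have "(\<lambda>n. LINT p|(T \<Otimes>\<^sub>M T). indicator (X n) p *\<^sub>R G p) \<longlonglongrightarrow> integral\<^sup>L (T \<Otimes>\<^sub>M T) G"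
  proof (rule integral_dominated_convergence)
    show "integrable (T \<Otimes>\<^sub>M T) (\<lambda>p. norm (G p))" using iG by (rule integrable_norm)
    show "AE p in T \<Otimes>\<^sub>M T. (\<lambda>n. indicator (X n) p *\<^sub>R G p) \<longlonglongrightarrow> G p"
      using AE_off
    proof eventually_elim
      case (elim p)
      hence "\<forall>\<^sub>F n in sequentially. e n < cmod (snd p - fst p)"
        by (intro order_tendstoD(2)[OF e_lim]) auto
      hence "\<forall>\<^sub>F n in sequentially. indicator (X n) p *\<^sub>R G p = G p"
        by eventually_elim (simp add: X_def)
      thus ?case by (rule tendsto_eventually)
    qed
  qed (measurable, auto simp: indicator_def)
  moreover have "(\<lambda>n. LINT \<zeta>|T. k \<zeta> * trunc (e n) \<zeta>) \<longlonglongrightarrow> (LINT \<zeta>|T. 0)"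
  proof (rule integral_dominated_convergence)
    let ?B = "\<lambda>\<zeta>. C * (1 / cmod (\<zeta> - z) * enn2real (D \<zeta>))"
    \<comment> \<open>\<open>enn2real\<close> maps \<infinity> to 0, so the majorant is valid only
      where \<open>D\<close> is finite. The point \<open>z\<close> has to be excluded: there 1 / 0 =
      0 makes the weighted integrand 0 even if \<open>D\<close> is infinite.\<close>
    have Dfin: "AE \<zeta> in T. D \<zeta> < \<infinity>"
    proof -
      have "AE \<zeta> in T. (1 + D \<zeta>) * ennreal (1 / cmod (\<zeta> - z)) \<noteq> \<infinity>"
        using fin by (intro nn_integral_PInf_AE) auto
      thus ?thesis using AE_neq[of z]
        by eventually_elim (auto simp: ennreal_mult_eq_top_iff less_top[symmetric] intro!: leI)
    qed
    show "integrable T ?B"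
    proof (rule integrable_mult_right, rule integrableI_bounded)
      have "(\<integral>\<^sup>+\<zeta>. ennreal (norm (1 / cmod (\<zeta> - z) * enn2real (D \<zeta>))) \<partial>T)
              \<le> (\<integral>\<^sup>+\<zeta>. (1 + D \<zeta>) * ennreal (1 / cmod (\<zeta> - z)) \<partial>T)"
      proof (rule nn_integral_mono_AE, use Dfin in eventually_elim)
        case (elim \<zeta>)
        have "ennreal (norm (1 / cmod (\<zeta> - z) * enn2real (D \<zeta>))) = ennreal (1 / cmod (\<zeta> - z)) * D \<zeta>"
          using elim by (cases "D \<zeta>") (auto simp flip: ennreal_mult)
        thus ?case by (simp add: mult.commute distrib_right)
      qed
      thus "(\<integral>\<^sup>+\<zeta>. ennreal (norm (1 / cmod (\<zeta> - z) * enn2real (D \<zeta>))) \<partial>T) < \<infinity>"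
        using fin by (rule le_less_trans)
    qed measurable
    show "AE \<zeta> in T. norm (k \<zeta> * trunc (e n) \<zeta>) \<le> ?B \<zeta>" for n
      using Dfin
    proof eventually_elim
      case (elim \<zeta>)
      have "cmod (trunc (e n) \<zeta>) \<le> enn2real (D \<zeta>)"
        using enn2real_mono[OF D_ge[OF e_pos[of n], of \<zeta>]] elim by simp
      hence "cmod (k \<zeta>) * cmod (trunc (e n) \<zeta>) \<le> (C * (1 / cmod (\<zeta> - z))) * enn2real (D \<zeta>)"
        by (intro mult_mono k_le) (auto simp: C_nonneg)
      thus ?case by (simp add: norm_mult)
    qed
    have e: "filterlim e (at_right 0) sequentially"
      using e_lim e_pos by (intro tendsto_imp_filterlim_at_right) auto
    show "AE \<zeta> in T. (\<lambda>n. k \<zeta> * trunc (e n) \<zeta>) \<longlonglongrightarrow> 0"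
      using lim
    proof eventually_elim
      case (elim \<zeta>)
      show ?case by (intro tendsto_mult_right_zero filterlim_compose[OF elim e])
    qed
  qed measurable
  hence "(\<lambda>n. 2 * (LINT \<zeta>|T. k \<zeta> * trunc (e n) \<zeta>)) \<longlonglongrightarrow> 0"
    using tendsto_mult_right_zero[of _ sequentially 2] by simp
  ultimately have "integral\<^sup>L (T \<Otimes>\<^sub>M T) G = 0"
    unfolding split by (rule LIMSEQ_unique)
  thus ?thesis unfolding intG by (simp add: k_def[abs_def])
qed

end


section \<open>The Cauchy kernel on lines and rectangles\<close>

text \<open>Taking the inverse in \<open>ennreal\<close> gives the value \<infinity> at 0. A finite
  potential thus also shows that the corresponding line is null.\<close>

definition sqrt_kernel :: "real \<Rightarrow> ennreal" where
  "sqrt_kernel t = inverse (ennreal (sqrt \<bar>t\<bar>))"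

lemma sqrt_kernel_measurable [measurable]: "sqrt_kernel \<in> borel_measurable borel"
  unfolding sqrt_kernel_def by measurable

lemma sqrt_kernel_minus: "sqrt_kernel (- t) = sqrt_kernel t"
  by (simp add: sqrt_kernel_def)

lemma sqrt_kernel_0: "sqrt_kernel 0 = \<infinity>"
  by (simp add: sqrt_kernel_def)

lemma sqrt_kernel_nonzero: "sqrt_kernel t \<noteq> 0"
  by (simp add: sqrt_kernel_def)

text \<open>Both |Re z| and |Im z| are at most |z|; take square roots and multiply. If a coordinate
  vanishes, the right side is \<infinity> because the other factor is never 0.\<close>

lemma inverse_cmod_le_sqrt_kernel:
  "ennreal (1 / cmod z) \<le> sqrt_kernel (Re z) * sqrt_kernel (Im z)"
proof (cases "Re z = 0 \<or> Im z = 0")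
  case True
  thus ?thesis
    using sqrt_kernel_nonzero by (auto simp: sqrt_kernel_0 ennreal_top_mult ennreal_mult_top)
next
  case False
  hence pos: "sqrt \<bar>Re z\<bar> > 0" "sqrt \<bar>Im z\<bar> > 0" by auto
  have "sqrt \<bar>Re z\<bar> * sqrt \<bar>Im z\<bar> \<le> sqrt (cmod z) * sqrt (cmod z)"
    by (intro mult_mono real_sqrt_le_mono abs_Re_le_cmod abs_Im_le_cmod) auto
  hence "1 / cmod z \<le> 1 / (sqrt \<bar>Re z\<bar> * sqrt \<bar>Im z\<bar>)"
    using pos by (intro divide_left_mono) (auto intro!: mult_pos_pos simp: zero_less_mult_iff)
  also have "\<dots> = inverse (sqrt \<bar>Re z\<bar>) * inverse (sqrt \<bar>Im z\<bar>)"
    by (simp add: divide_simps)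
  finally have "ennreal (1 / cmod z) \<le> ennreal (inverse (sqrt \<bar>Re z\<bar>) * inverse (sqrt \<bar>Im z\<bar>))"
    by (rule ennreal_leI)
  also have "\<dots> = sqrt_kernel (Re z) * sqrt_kernel (Im z)"
    using pos by (simp add: sqrt_kernel_def inverse_ennreal ennreal_mult)
  finally show ?thesis .
qed

lemma nn_integral_sqrt_kernel_Icc_0_1: "(\<integral>\<^sup>+t\<in>{0..1}. sqrt_kernel t \<partial>lborel) = 2"
proof -
  have "((\<lambda>x::real. x powr (-1/2)) has_integral (1 powr (-1/2+1) / (-1/2+1))) {0..1}"
    by (rule has_integral_powr_from_0) auto
  hence "(\<integral>\<^sup>+t. ennreal (t powr (-1/2)) * indicator {0..1} t \<partial>lborel) = ennreal 2"
    by (subst nn_integral_has_integral_lebesgue') auto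
  moreover have "(\<integral>\<^sup>+t\<in>{0..1}. sqrt_kernel t \<partial>lborel)
                   = (\<integral>\<^sup>+t. ennreal (t powr (-1/2)) * indicator {0..1} t \<partial>lborel)"
  proof (rule nn_integral_cong_AE)
    \<comment> \<open>The integrands differ at t = 0, where \<open>powr\<close> gives 0 and the
      kernel \<infinity>.\<close>
    show "AE t in lborel. sqrt_kernel t * indicator {0..1} t
            = ennreal (t powr (-1/2)) * indicator {0..1} t"
      using AE_lborel_singleton[of 0]
    proof eventually_elim
      case (elim t)
      show ?case
        using elim
        by (auto simp: indicator_def sqrt_kernel_def inverse_ennreal powr_minus powr_half_sqrt)
    qed
  qed
  ultimately show ?thesis by simp
qed

text \<open>Within distance 1 of c each side contributes at most 2, and farther away the kernel is
  at most 1. The bound is uniform in c, as the later uses of Tonelli require.\<close>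

lemma nn_integral_sqrt_kernel_le:
  fixes a b c :: real
  assumes "a \<le> b"
  shows "(\<integral>\<^sup>+t\<in>{a..b}. sqrt_kernel (t - c) \<partial>lborel) \<le> ennreal (4 + (b - a))"
proof -
  let ?f = "\<lambda>t. sqrt_kernel t * indicator {0..1} t"
  have shift: "(\<integral>\<^sup>+t. ?f (t - c) \<partial>lborel) = 2" "(\<integral>\<^sup>+t. ?f (c - t) \<partial>lborel) = 2"
    using nn_integral_real_affine[of ?f 1 "-c"] nn_integral_real_affine[of ?f "-1" c]
      nn_integral_sqrt_kernel_Icc_0_1 by simp_all
  have "(\<integral>\<^sup>+t\<in>{a..b}. sqrt_kernel (t - c) \<partial>lborel)
          \<le> (\<integral>\<^sup>+t. ?f (t - c) + ?f (c - t) + indicator {a..b} t \<partial>lborel)"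
  proof (rule nn_integral_mono)
    fix t
    have sym: "sqrt_kernel (c - t) = sqrt_kernel (t - c)" using sqrt_kernel_minus[of "t - c"] by simp
    consider "0 \<le> t - c" "t - c \<le> 1" | "0 \<le> c - t" "c - t \<le> 1" | "\<bar>t - c\<bar> > 1" by linarith
    thus "sqrt_kernel (t - c) * indicator {a..b} t \<le> ?f (t - c) + ?f (c - t) + indicator {a..b} t"
    proof cases
      case 3
      hence "inverse (sqrt \<bar>t - c\<bar>) \<le> 1" by (simp add: inverse_le_1_iff)
      hence "sqrt_kernel (t - c) \<le> 1"
        using 3 by (simp add: sqrt_kernel_def inverse_ennreal)
      thus ?thesis by (auto simp: indicator_def intro: add_increasing)
    qed (auto simp: indicator_def sym intro: add_increasing2)
  qed
  also have "\<dots> = 4 + ennreal (b - a)"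
    using assms by (simp add: nn_integral_add shift)
  also have "\<dots> = ennreal (4 + (b - a))"
    using assms by simp
  finally show ?thesis .
qed

text \<open>By Tonelli the potential has integral at most 4 + 2n times the integral of
  \<open>w\<close> over [-n, n], so it is finite almost everywhere there.\<close>

lemma AE_sqrt_kernel_potential_finite:
  fixes p :: "'a \<Rightarrow> real" and w :: "'a \<Rightarrow> ennreal"
  assumes "sigma_finite_measure M"
    and [measurable]: "p \<in> borel_measurable M" "w \<in> borel_measurable M"
    and fin: "(\<integral>\<^sup>+x. w x \<partial>M) < \<infinity>"
  shows "AE s in lborel. (\<integral>\<^sup>+x. w x * sqrt_kernel (s - p x) \<partial>M) < \<infinity>"
proof -
  interpret M: sigma_finite_measure M by fact
  interpret pair_sigma_finite lborel M ..
  have "AE s in lborel. s \<in> {- real n..real n} \<longrightarrow> (\<integral>\<^sup>+x. w x * sqrt_kernel (s - p x) \<partial>M) < \<infinity>" for n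
  proof -
    let ?I = "{- real n..real n}"
    have "(\<integral>\<^sup>+s. (\<integral>\<^sup>+x. w x * sqrt_kernel (s - p x) \<partial>M) * indicator ?I s \<partial>lborel)
            = (\<integral>\<^sup>+s. (\<integral>\<^sup>+x. w x * (sqrt_kernel (s - p x) * indicator ?I s) \<partial>M) \<partial>lborel)"
      by (simp add: nn_integral_multc[symmetric] mult.assoc)
    also have "\<dots> = (\<integral>\<^sup>+x. (\<integral>\<^sup>+s. w x * (sqrt_kernel (s - p x) * indicator ?I s) \<partial>lborel) \<partial>M)"
      by (rule Fubini'[symmetric]) measurable
    also have "\<dots> = (\<integral>\<^sup>+x. w x * (\<integral>\<^sup>+s\<in>?I. sqrt_kernel (s - p x) \<partial>lborel) \<partial>M)"
      by (intro nn_integral_cong nn_integral_cmult) measurable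
    also have "\<dots> \<le> (\<integral>\<^sup>+x. w x * ennreal (4 + (real n - - real n)) \<partial>M)"
      by (intro nn_integral_mono mult_left_mono nn_integral_sqrt_kernel_le) auto
    also have "\<dots> < \<infinity>"
      using fin by (simp add: nn_integral_multc ennreal_mult_less_top)
    finally have "AE s in lborel. (\<integral>\<^sup>+x. w x * sqrt_kernel (s - p x) \<partial>M) * indicator ?I s \<noteq> \<infinity>"
      by (intro nn_integral_PInf_AE) auto
    thus ?thesis by eventually_elim (auto simp: less_top)
  qed
  hence "AE s in lborel. \<forall>n. s \<in> {- real n..real n} \<longrightarrow> (\<integral>\<^sup>+x. w x * sqrt_kernel (s - p x) \<partial>M) < \<infinity>"
    unfolding AE_all_countable by blast
  thus ?thesis
  proof eventually_elim
    case (elim s)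
    obtain n where "\<bar>s\<bar> \<le> real n" using real_arch_simple by blast
    hence "s \<in> {- real n..real n}" by auto
    thus ?case using elim by blast
  qed
qed

lemma AE_lborel_dense:
  fixes u v :: real
  assumes "AE x in lborel. P x" "u < v"
  obtains x where "u < x" "x < v" "P x"
proof -
  have "\<exists>x. u < x \<and> x < v \<and> P x"
  proof (rule ccontr)
    assume "\<not> ?thesis"
    hence "AE x in lborel. x \<notin> {u<..<v}"
      using assms(1) by (auto elim: eventually_mono)
    hence "emeasure lborel {u<..<v} = 0" by (subst (asm) AE_iff_measurable[of "{u<..<v}"]) auto
    thus False using assms(2) by simp
  qed
  thus thesis using that by blast
qed

section \<open>The Cauchy kernel integrated around a rectangle\<close>

lemma has_contour_integral_linepath_same_Im_iff:
  assumes "a < b"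
  shows "(f has_contour_integral I) (linepath (Complex a c) (Complex b c)) \<longleftrightarrow>
           ((\<lambda>x. f (Complex x c)) has_integral I) {a..b}"
proof -
  have *: "linepath (Complex a c) (Complex b c) t = linepath (of_real a) (of_real b) t + Complex 0 c" for t
    by (simp add: linepath_def complex_eq_iff algebra_simps)
  have "(f has_contour_integral I) (linepath (Complex a c) (Complex b c)) \<longleftrightarrow>
          ((\<lambda>z. f (z + Complex 0 c)) has_contour_integral I) (linepath (of_real a) (of_real b))"
    unfolding has_contour_integral_linepath *
    by (simp add: complex_diff complex_eq_iff complex_of_real_def)
  also have "\<dots> \<longleftrightarrow> ((\<lambda>x. f (of_real x + Complex 0 c)) has_integral I) {a..b}"
    using assms by (subst has_contour_integral_linepath_Reals_iff) auto
  also have "(\<lambda>x. f (of_real x + Complex 0 c)) = (\<lambda>x. f (Complex x c))"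
    by (simp add: complex_of_real_def complex_add)
  finally show ?thesis .
qed

text \<open>The minus sign reconciles the contour kernel 1 / (w - \<zeta>) with the kernel 1 /
  (\<zeta> - w) of the transform. The lemma also passes from the Lebesgue to the gauge
  integral.\<close>

lemma has_integral_inverse_line:
  fixes \<gamma> :: "real \<Rightarrow> complex"
  assumes "continuous_on {a..b} \<gamma>" "\<And>t. t \<in> {a..b} \<Longrightarrow> \<gamma> t \<noteq> \<zeta>"
  shows "((\<lambda>t. 1 / (\<gamma> t - \<zeta>)) has_integral - (LINT t:{a..b}|lborel. 1 / (\<zeta> - \<gamma> t))) {a..b}"
proof -
  have "continuous_on {a..b} (\<lambda>t. 1 / (\<zeta> - \<gamma> t))"
    using assms by (intro continuous_intros) force+
  hence "set_integrable lborel {a..b} (\<lambda>t. 1 / (\<zeta> - \<gamma> t))"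
    by (rule borel_integrable_atLeastAtMost')
  hence "((\<lambda>t. 1 / (\<zeta> - \<gamma> t)) has_integral (LINT t:{a..b}|lborel. 1 / (\<zeta> - \<gamma> t))) {a..b}"
    using set_borel_integral_eq_integral by (metis integrable_integral)
  from has_integral_neg[OF this] show ?thesis
    by (rule has_integral_eq[rotated]) (metis minus_diff_eq minus_divide_right)
qed

text \<open>This is 2\<pi>\<i> times the winding number of the boundary about \<zeta>, written side
  by side; on vertical sides dw = \<i> dy. Keeping \<zeta> off the four lines makes every side
  integral one of a continuous function.\<close>

lemma rectangle_cauchy_kernel:
  fixes a b c d :: real and \<zeta> :: complex
  assumes "a < b" "c < d" and \<zeta>: "Re \<zeta> \<noteq> a" "Re \<zeta> \<noteq> b" "Im \<zeta> \<noteq> c" "Im \<zeta> \<noteq> d"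
  defines "H \<equiv> \<lambda>y. LINT x:{a..b}|lborel. 1 / (\<zeta> - Complex x y)"
    and "V \<equiv> \<lambda>x. LINT y:{c..d}|lborel. 1 / (\<zeta> - Complex x y)"
  shows "H d - H c + \<i> * (V a - V b)
           = 2 * pi * \<i> * indicator (box (Complex a c) (Complex b d)) \<zeta>"
proof -
  let ?A = "Complex a c" and ?B = "Complex b d"
  let ?f = "\<lambda>w. 1 / (w - \<zeta>)"
  have H: "(?f has_contour_integral - H y) (linepath (Complex a y) (Complex b y))" if "Im \<zeta> \<noteq> y" for y
    unfolding has_contour_integral_linepath_same_Im_iff[OF \<open>a < b\<close>] H_def
    by (rule has_integral_inverse_line) (use that in \<open>auto intro!: continuous_intros simp: Complex_eq\<close>)
  have V: "(?f has_contour_integral - \<i> * V x) (linepath (Complex x c) (Complex x d))" if "Re \<zeta> \<noteq> x" for x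
  proof -
    have "((\<lambda>y. ?f (Complex x y)) has_integral - V x) {c..d}"
      unfolding V_def
      by (rule has_integral_inverse_line) (use that in \<open>auto intro!: continuous_intros simp: Complex_eq\<close>)
    thus ?thesis
      by (subst has_contour_integral_linepath_same_Re_iff[of _ x _ c d]) (use \<open>c < d\<close> in auto)
  qed
  have "(?f has_contour_integral (- H c + (- \<i> * V b + (H d + \<i> * V a)))) (rectpath ?A ?B)"
    using H[of c] V[of b] has_contour_integral_reverse_linepath[OF H[of d]]
      has_contour_integral_reverse_linepath[OF V[of a]] \<zeta>
    unfolding rectpath_def Let_def
    by (intro has_contour_integral_join valid_path_join) auto
  hence I: "contour_integral (rectpath ?A ?B) ?f = - H c + (- \<i> * V b + (H d + \<i> * V a))"
    by (rule contour_integral_unique)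
  have not: "\<zeta> \<notin> path_image (rectpath ?A ?B)"
    using assms by (subst path_image_rectpath) auto
  have "winding_number (rectpath ?A ?B) \<zeta> = indicator (box ?A ?B) \<zeta>"
  proof (cases "\<zeta> \<in> box ?A ?B")
    case True
    thus ?thesis by (simp add: winding_number_rectpath)
  next
    case False
    \<comment> \<open>Since \<zeta> avoids the lines carrying the sides, lying outside the open box
      means lying outside the closed one.\<close>
    hence "\<zeta> \<notin> cbox ?A ?B"
      using \<zeta> by (auto simp: in_box_complex_iff in_cbox_complex_iff)
    thus ?thesis using assms False by (subst winding_number_rectpath_outside) auto
  qed
  moreover have "winding_number (rectpath ?A ?B) \<zeta> = 1/(2*pi*\<i>) * contour_integral (rectpath ?A ?B) ?f"
    by (rule winding_number_valid_path[OF valid_path_rectpath not])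
  ultimately show ?thesis unfolding I by (simp add: field_simps)
qed


section \<open>Vanishing on rectangles\<close>

context bounded_density
begin

section \<open>Determination of the measure by its values on boxes\<close>

lemma integrable_density_indicator:
  assumes "A \<in> sets borel"
  shows "integrable T (\<lambda>\<zeta>. h \<zeta> * indicator A \<zeta>)"
  by (rule integrable_const_bound[of _ C])
     (use h_bounded C_nonneg assms in \<open>auto simp: indicator_def\<close>)

text \<open>Dominated convergence with the constant majorant C. It serves the exhaustion of the
  plane, countable unions, and the approximation of a box from inside.\<close>

lemma integral_indicator_tendsto:
  assumes A: "\<And>n::nat. A n \<in> sets borel" "B \<in> sets borel"
    and lim: "\<And>\<zeta>. \<forall>\<^sub>F n in sequentially. \<zeta> \<in> A n \<longleftrightarrow> \<zeta> \<in> B"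
  shows "(\<lambda>n. LINT \<zeta>|T. h \<zeta> * indicator (A n) \<zeta>) \<longlonglongrightarrow> (LINT \<zeta>|T. h \<zeta> * indicator B \<zeta>)"
proof (rule integral_dominated_convergence)
  show "AE \<zeta> in T. (\<lambda>n. h \<zeta> * indicator (A n) \<zeta>) \<longlonglongrightarrow> h \<zeta> * indicator B \<zeta>"
    by (intro AE_I2 tendsto_eventually eventually_mono[OF lim]) (auto simp: indicator_def)
  show "integrable T (\<lambda>_. C)" by simp
qed (use A h_bounded C_nonneg in \<open>auto simp: indicator_def\<close>)

text \<open>Boxes are stable under intersection and generate the Borel sets, and the sets of zero
  integral form a Dynkin system.\<close>

lemma integral_indicator_eq_0_if_boxes:
  assumes box: "\<And>p q. (LINT \<zeta>|T. h \<zeta> * indicator (box p q) \<zeta>) = 0" and "A \<in> sets borel"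
  shows "(LINT \<zeta>|T. h \<zeta> * indicator A \<zeta>) = 0"
proof -
  let ?G = "range (\<lambda>(a, b). box a b :: complex set)"
  have sets: "sets borel = sigma_sets UNIV ?G" by (subst borel_eq_box) (simp add: sets_measure_of)
  have "Int_stable ?G" by (auto simp: Int_stable_def box_Int_box)
  moreover have "?G \<subseteq> Pow UNIV" by simp
  moreover have "A \<in> sigma_sets UNIV ?G" using assms(2) sets by simp
  ultimately show ?thesis
  proof (induction rule: sigma_sets_induct_disjoint)
    case (compl A)
    have A: "A \<in> sets borel" using compl(1) sets by simp
    \<comment> \<open>Passing to complements requires that the integral over the whole plane vanish;
      growing squares exhaust it.\<close>
    have "(\<lambda>n. LINT \<zeta>|T. h \<zeta> * indicator (box (Complex (- real n) (- real n)) (Complex n n)) \<zeta>)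
            \<longlonglongrightarrow> (LINT \<zeta>|T. h \<zeta> * indicator UNIV \<zeta>)"
    proof (rule integral_indicator_tendsto)
      fix \<zeta> :: complex
      have "\<forall>\<^sub>F n in sequentially. cmod \<zeta> < real n"
        by (rule eventually_compose_filterlim[OF eventually_gt_at_top filterlim_real_sequentially])
      thus "\<forall>\<^sub>F n in sequentially.
              \<zeta> \<in> box (Complex (- real n) (- real n)) (Complex n n) \<longleftrightarrow> \<zeta> \<in> UNIV"
      proof eventually_elim
        case (elim n)
        thus ?case
          using abs_Re_le_cmod[of \<zeta>] abs_Im_le_cmod[of \<zeta>] by (simp add: in_box_complex_iff) linarith
      qed
    qed auto
    hence UNIV: "(LINT \<zeta>|T. h \<zeta> * indicator UNIV \<zeta>) = 0"
      unfolding box by (simp add: LIMSEQ_const_iff)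
    have "(LINT \<zeta>|T. h \<zeta> * indicator (UNIV - A) \<zeta>)
            = (LINT \<zeta>|T. h \<zeta> * indicator UNIV \<zeta> - h \<zeta> * indicator A \<zeta>)"
      by (intro Bochner_Integration.integral_cong) (auto simp: indicator_def)
    thus ?case using UNIV compl A integrable_density_indicator[of UNIV]
      by (simp add: integrable_density_indicator)
  next
    case (union A)
    have A: "A i \<in> sets borel" for i using union(2) sets by auto
    have "(LINT \<zeta>|T. h \<zeta> * indicator (\<Union>i<n. A i) \<zeta>) = 0" for n
    proof -
      have "(LINT \<zeta>|T. h \<zeta> * indicator (\<Union>i<n. A i) \<zeta>)
              = (LINT \<zeta>|T. (\<Sum>i<n. h \<zeta> * indicator (A i) \<zeta>))"
        using union(1)
        by (intro Bochner_Integration.integral_cong refl)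
           (simp add: indicator_UN_disjoint disjoint_family_on_mono[of _ UNIV] sum_distrib_left)
      also have "\<dots> = (\<Sum>i<n. LINT \<zeta>|T. h \<zeta> * indicator (A i) \<zeta>)"
        by (intro Bochner_Integration.integral_sum integrable_density_indicator A)
      finally show ?thesis by (simp add: union(3))
    qed
    moreover have "(\<lambda>n. LINT \<zeta>|T. h \<zeta> * indicator (\<Union>i<n. A i) \<zeta>)
                     \<longlonglongrightarrow> (LINT \<zeta>|T. h \<zeta> * indicator (\<Union>i. A i) \<zeta>)"
    proof (rule integral_indicator_tendsto)
      fix \<zeta>
      show "\<forall>\<^sub>F n in sequentially. \<zeta> \<in> (\<Union>i<n. A i) \<longleftrightarrow> \<zeta> \<in> (\<Union>i. A i)"
      proof (cases "\<exists>i. \<zeta> \<in> A i")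
        case True
        then obtain i where "\<zeta> \<in> A i" by blast
        thus ?thesis by (intro eventually_mono[OF eventually_gt_at_top[of i]]) auto
      qed auto
    qed (use A in auto)
    ultimately show ?case by (simp add: LIMSEQ_const_iff)
  qed (use box in auto)
qed

section \<open>Vanishing of the side integrals and of the boxes\<close>

text \<open>\<open>D\<close> stands for the maximal function: an integrable majorant of all
  truncations.\<close>

context
  fixes D :: "complex \<Rightarrow> ennreal"
  assumes D[measurable]: "D \<in> borel_measurable borel"
    and D_ge: "\<And>\<epsilon> \<zeta>. \<epsilon> > 0 \<Longrightarrow> ennreal (cmod (trunc \<epsilon> \<zeta>)) \<le> D \<zeta>"
    and D_fin: "(\<integral>\<^sup>+\<zeta>. D \<zeta> \<partial>T) < \<infinity>"
    and lim: "AE \<zeta> in T. ((\<lambda>\<epsilon>. trunc \<epsilon> \<zeta>) \<longlongrightarrow> 0) (at_right 0)"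
begin

text \<open>In the applications \<open>\<gamma>\<close> runs along a horizontal or vertical line,
  \<open>\<alpha> \<zeta>\<close> is the signed distance of \<zeta> from it and
  \<open>\<beta> \<zeta>\<close> the coordinate of \<zeta> along it. The transform vanishes at
  almost every point of the segment, and Fubini moves the line integral inside.\<close>

lemma has_integral_line_0:
  fixes \<gamma> :: "real \<Rightarrow> complex" and \<alpha> \<beta> :: "complex \<Rightarrow> real"
  assumes [measurable]: "\<gamma> \<in> borel_measurable borel" "\<alpha> \<in> borel_measurable borel" "\<beta> \<in> borel_measurable borel"
    and le: "\<And>\<zeta> t. ennreal (1 / cmod (\<zeta> - \<gamma> t)) \<le> sqrt_kernel (\<alpha> \<zeta>) * sqrt_kernel (t - \<beta> \<zeta>)"
    and fin: "(\<integral>\<^sup>+\<zeta>. (1 + D \<zeta>) * sqrt_kernel (\<alpha> \<zeta>) \<partial>T) < \<infinity>" and "a \<le> b"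
  shows "has_bochner_integral T (\<lambda>\<zeta>. h \<zeta> * (LINT t:{a..b}|lborel. 1 / (\<zeta> - \<gamma> t))) 0"
proof -
  interpret L: pair_sigma_finite lborel T ..
  define f where "f t \<zeta> = indicator {a..b} t *\<^sub>R (h \<zeta> / (\<zeta> - \<gamma> t))" for t \<zeta>
  let ?g = "\<lambda>t \<zeta>. (1 + D \<zeta>) * ennreal (1 / cmod (\<zeta> - \<gamma> t)) * indicator {a..b} t"
  have fm [measurable]: "case_prod f \<in> borel_measurable (lborel \<Otimes>\<^sub>M T)"
    unfolding f_def by measurable
  \<comment> \<open>This estimate is used twice: to justify Fubini for \<open>f\<close>, and to
    verify the finiteness assumption of \<open>cauchy_transform_eq_0\<close> for almost every
    \<open>t\<close>.\<close>
  have "(\<integral>\<^sup>+t. (\<integral>\<^sup>+\<zeta>. ?g t \<zeta> \<partial>T) \<partial>lborel) = (\<integral>\<^sup>+\<zeta>. (\<integral>\<^sup>+t. ?g t \<zeta> \<partial>lborel) \<partial>T)"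
    by (rule L.Fubini'[symmetric]) measurable
  also have "\<dots> \<le> (\<integral>\<^sup>+\<zeta>. (1 + D \<zeta>) * sqrt_kernel (\<alpha> \<zeta>) * ennreal (4 + (b - a)) \<partial>T)"
  proof (rule nn_integral_mono)
    fix \<zeta>
    have "(\<integral>\<^sup>+t. ?g t \<zeta> \<partial>lborel)
            \<le> (\<integral>\<^sup>+t. (1 + D \<zeta>) * sqrt_kernel (\<alpha> \<zeta>) * (sqrt_kernel (t - \<beta> \<zeta>) * indicator {a..b} t) \<partial>lborel)"
      unfolding mult.assoc by (intro nn_integral_mono mult_left_mono)
        (use le in \<open>auto simp: indicator_def\<close>)
    also have "\<dots> = (1 + D \<zeta>) * sqrt_kernel (\<alpha> \<zeta>) * (\<integral>\<^sup>+t\<in>{a..b}. sqrt_kernel (t - \<beta> \<zeta>) \<partial>lborel)"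
      by (rule nn_integral_cmult) measurable
    also have "\<dots> \<le> (1 + D \<zeta>) * sqrt_kernel (\<alpha> \<zeta>) * ennreal (4 + (b - a))"
      by (intro mult_left_mono nn_integral_sqrt_kernel_le \<open>a \<le> b\<close>) simp
    finally show "(\<integral>\<^sup>+t. ?g t \<zeta> \<partial>lborel) \<le> \<dots>" .
  qed
  also have "\<dots> < \<infinity>"
    using fin by (simp add: nn_integral_multc ennreal_mult_less_top)
  finally have B: "(\<integral>\<^sup>+t. (\<integral>\<^sup>+\<zeta>. ?g t \<zeta> \<partial>T) \<partial>lborel) < \<infinity>" .
  have int: "integrable (lborel \<Otimes>\<^sub>M T) (case_prod f)"
  proof (rule integrableI_bounded[OF fm])
    have "(\<integral>\<^sup>+p. ennreal (norm (case_prod f p)) \<partial>(lborel \<Otimes>\<^sub>M T))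
            = (\<integral>\<^sup>+t. (\<integral>\<^sup>+\<zeta>. ennreal (norm (f t \<zeta>)) \<partial>T) \<partial>lborel)"
      using nn_integral_fst[of "\<lambda>p. ennreal (norm (case_prod f p))" lborel] by simp
    also have "\<dots> \<le> (\<integral>\<^sup>+t. (\<integral>\<^sup>+\<zeta>. ennreal C * ?g t \<zeta> \<partial>T) \<partial>lborel)"
    proof (intro nn_integral_mono)
      fix t \<zeta>
      have "norm (f t \<zeta>) \<le> C * (1 / cmod (\<zeta> - \<gamma> t)) * indicator {a..b} t"
        using h_bounded[of \<zeta>] C_nonneg
        by (auto simp: f_def indicator_def norm_divide divide_right_mono)
      hence "ennreal (norm (f t \<zeta>)) \<le> ennreal (C * (1 / cmod (\<zeta> - \<gamma> t)) * indicator {a..b} t)"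
        by (rule ennreal_leI)
      also have "\<dots> = ennreal C * (1 * ennreal (1 / cmod (\<zeta> - \<gamma> t)) * indicator {a..b} t)"
        by (cases "t \<in> {a..b}")
           (simp_all add: ennreal_mult'[OF C_nonneg] del: times_divide_eq_right)
      also have "\<dots> \<le> ennreal C * ?g t \<zeta>"
        by (intro mult_left_mono mult_right_mono) auto
      finally show "ennreal (norm (f t \<zeta>)) \<le> ennreal C * ?g t \<zeta>" .
    qed
    also have "\<dots> = ennreal C * (\<integral>\<^sup>+t. (\<integral>\<^sup>+\<zeta>. ?g t \<zeta> \<partial>T) \<partial>lborel)"
      by (simp add: nn_integral_cmult)
    also have "\<dots> < \<infinity>" using B by (simp add: ennreal_mult_less_top)
    finally show "(\<integral>\<^sup>+p. ennreal (norm (case_prod f p)) \<partial>(lborel \<Otimes>\<^sub>M T)) < \<infinity>" .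
  qed
  have "AE t in lborel. (\<integral>\<^sup>+\<zeta>. ?g t \<zeta> \<partial>T) \<noteq> \<infinity>"
    using B by (intro nn_integral_PInf_AE) auto
  hence "AE t in lborel. (LINT \<zeta>|T. f t \<zeta>) = 0"
  proof eventually_elim
    case (elim t)
    show ?case
    proof (cases "t \<in> {a..b}")
      case True
      hence "(\<integral>\<^sup>+\<zeta>. (1 + D \<zeta>) * ennreal (1 / cmod (\<zeta> - \<gamma> t)) \<partial>T) < \<infinity>"
        using elim by (simp add: less_top)
      from cauchy_transform_eq_0[OF D D_ge lim this] show ?thesis using True by (simp add: f_def)
    qed (simp add: f_def)
  qed
  hence "(LINT t|lborel. LINT \<zeta>|T. f t \<zeta>) = 0"
    by (rule integral_eq_zero_AE)
  hence "(LINT \<zeta>|T. LINT t|lborel. f t \<zeta>) = 0"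
    using L.Fubini_integral[OF int] by simp
  moreover have "integrable T (\<lambda>\<zeta>. LINT t|lborel. f t \<zeta>)"
    by (rule L.integrable_snd[OF int])
  moreover have "(LINT t|lborel. f t \<zeta>) = h \<zeta> * (LINT t:{a..b}|lborel. 1 / (\<zeta> - \<gamma> t))" for \<zeta>
    unfolding set_lebesgue_integral_def integral_mult_right_zero[symmetric]
    by (intro Bochner_Integration.integral_cong) (auto simp: f_def)
  ultimately show ?thesis by (simp add: has_bochner_integral_iff)
qed

text \<open>Where p = s the kernel is \<infinity> and the weight at least 1, so a finite integral
  forces this level set to be null.\<close>

lemma AE_neq_of_finite_potential:
  fixes p :: "complex \<Rightarrow> real"
  assumes [measurable]: "p \<in> borel_measurable borel"
    and fin: "(\<integral>\<^sup>+\<zeta>. (1 + D \<zeta>) * sqrt_kernel (s - p \<zeta>) \<partial>T) < \<infinity>"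
  shows "AE \<zeta> in T. p \<zeta> \<noteq> s"
proof -
  have "AE \<zeta> in T. (1 + D \<zeta>) * sqrt_kernel (s - p \<zeta>) \<noteq> \<infinity>"
    using fin by (intro nn_integral_PInf_AE) auto
  thus ?thesis by eventually_elim (auto simp: sqrt_kernel_0 ennreal_mult_top)
qed

text \<open>The integrals of \<open>h\<close> against the four side kernels vanish, and
  \<open>rectangle_cauchy_kernel\<close> combines them into 2\<pi>\<i> times the integral of
  \<open>h\<close> over the box.\<close>

lemma integral_box_eq_0_if_finite_potential:
  assumes fin: "(\<integral>\<^sup>+\<zeta>. (1 + D \<zeta>) * sqrt_kernel (a - Re \<zeta>) \<partial>T) < \<infinity>"
      "(\<integral>\<^sup>+\<zeta>. (1 + D \<zeta>) * sqrt_kernel (b - Re \<zeta>) \<partial>T) < \<infinity>"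
      "(\<integral>\<^sup>+\<zeta>. (1 + D \<zeta>) * sqrt_kernel (c - Im \<zeta>) \<partial>T) < \<infinity>"
      "(\<integral>\<^sup>+\<zeta>. (1 + D \<zeta>) * sqrt_kernel (d - Im \<zeta>) \<partial>T) < \<infinity>"
  shows "(LINT \<zeta>|T. h \<zeta> * indicator (box (Complex a c) (Complex b d)) \<zeta>) = 0"
proof (cases "a < b \<and> c < d")
  case False
  hence "box (Complex a c) (Complex b d) = {}" by (auto simp: in_box_complex_iff)
  thus ?thesis by simp
next
  case True
  define H where "H y \<zeta> = (LINT x:{a..b}|lborel. 1 / (\<zeta> - Complex x y))" for y \<zeta>
  define V where "V x \<zeta> = (LINT y:{c..d}|lborel. 1 / (\<zeta> - Complex x y))" for x \<zeta>
  have H: "has_bochner_integral T (\<lambda>\<zeta>. h \<zeta> * H y \<zeta>) 0"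
    if "(\<integral>\<^sup>+\<zeta>. (1 + D \<zeta>) * sqrt_kernel (y - Im \<zeta>) \<partial>T) < \<infinity>" for y
    unfolding H_def
  proof (rule has_integral_line_0[where \<alpha> = "\<lambda>\<zeta>. y - Im \<zeta>" and \<beta> = Re])
    fix \<zeta> x
    show "ennreal (1 / cmod (\<zeta> - Complex x y)) \<le> sqrt_kernel (y - Im \<zeta>) * sqrt_kernel (x - Re \<zeta>)"
      using inverse_cmod_le_sqrt_kernel[of "Complex x y - \<zeta>"]
      by (simp add: norm_minus_commute mult.commute)
  qed (use that True in \<open>auto simp: Complex_eq\<close>)
  have V: "has_bochner_integral T (\<lambda>\<zeta>. h \<zeta> * V x \<zeta>) 0"
    if "(\<integral>\<^sup>+\<zeta>. (1 + D \<zeta>) * sqrt_kernel (x - Re \<zeta>) \<partial>T) < \<infinity>" for x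
    unfolding V_def
  proof (rule has_integral_line_0[where \<alpha> = "\<lambda>\<zeta>. x - Re \<zeta>" and \<beta> = Im])
    fix \<zeta> y
    show "ennreal (1 / cmod (\<zeta> - Complex x y)) \<le> sqrt_kernel (x - Re \<zeta>) * sqrt_kernel (y - Im \<zeta>)"
      using inverse_cmod_le_sqrt_kernel[of "Complex x y - \<zeta>"]
      by (simp add: norm_minus_commute)
  qed (use that True in \<open>auto simp: Complex_eq\<close>)
  let ?S = "\<lambda>\<zeta>. h \<zeta> * H d \<zeta> - h \<zeta> * H c \<zeta> + \<i> * (h \<zeta> * V a \<zeta> - h \<zeta> * V b \<zeta>)"
  have "has_bochner_integral T ?S (0 - 0 + \<i> * (0 - 0))"
    by (intro has_bochner_integral_add has_bochner_integral_diff has_bochner_integral_mult_right H V fin)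
  hence S: "integrable T ?S" "(LINT \<zeta>|T. ?S \<zeta>) = 0" by (simp_all add: has_bochner_integral_iff)
  have "(LINT \<zeta>|T. ?S \<zeta>)
          = (LINT \<zeta>|T. 2 * pi * \<i> * (h \<zeta> * indicator (box (Complex a c) (Complex b d)) \<zeta>))"
  proof (rule integral_cong_AE)
    \<comment> \<open>The lines carrying the sides are null, so the kernel identity holds for almost
      every \<zeta>.\<close>
    have "AE \<zeta> in T. Re \<zeta> \<noteq> a" "AE \<zeta> in T. Re \<zeta> \<noteq> b" "AE \<zeta> in T. Im \<zeta> \<noteq> c" "AE \<zeta> in T. Im \<zeta> \<noteq> d"
      by (intro AE_neq_of_finite_potential fin; measurable)+
    thus "AE \<zeta> in T. ?S \<zeta> = 2 * pi * \<i> * (h \<zeta> * indicator (box (Complex a c) (Complex b d)) \<zeta>)"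
    proof eventually_elim
      case (elim \<zeta>)
      have "?S \<zeta> = h \<zeta> * (H d \<zeta> - H c \<zeta> + \<i> * (V a \<zeta> - V b \<zeta>))" by (simp add: algebra_simps)
      also have "\<dots> = h \<zeta> * (2 * pi * \<i> * indicator (box (Complex a c) (Complex b d)) \<zeta>)"
        unfolding H_def V_def using True elim by (subst rectangle_cauchy_kernel) auto
      finally show ?case by (simp add: mult_ac)
    qed
  qed (use S in auto)
  thus ?thesis using S(2) by simp
qed

text \<open>Almost every line parallel to an axis has finite potential, so any box is a limit of
  boxes with sides on such lines.\<close>

lemma integral_box_eq_0: "(LINT \<zeta>|T. h \<zeta> * indicator (box p q) \<zeta>) = 0"
proof -
  have fin: "(\<integral>\<^sup>+\<zeta>. 1 + D \<zeta> \<partial>T) < \<infinity>"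
    using D_fin by (simp add: nn_integral_add less_top[symmetric])
  have good: "\<exists>x. (\<integral>\<^sup>+\<zeta>. (1 + D \<zeta>) * sqrt_kernel (x - r \<zeta>) \<partial>T) < \<infinity> \<and> u < x \<and> x < v"
    if "u < v" "r \<in> borel_measurable borel" for u v and r :: "complex \<Rightarrow> real"
  proof -
    have "AE x in lborel. (\<integral>\<^sup>+\<zeta>. (1 + D \<zeta>) * sqrt_kernel (x - r \<zeta>) \<partial>T) < \<infinity>"
      using that(2) fin by (intro AE_sqrt_kernel_potential_finite sigma_finite_measure_axioms) auto
    from AE_lborel_dense[OF this that(1)] show ?thesis by blast
  qed
  define e where "e n = 1 / real (Suc n)" for n
  have e_pos: "e n > 0" for n by (simp add: e_def)
  have e_lim: "e \<longlonglongrightarrow> 0" unfolding e_def by (rule LIMSEQ_Suc) (rule lim_1_over_n)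
  \<comment> \<open>Each side is moved strictly inwards by less than \<open>e n\<close>: the new
    boxes stay inside \<open>box p q\<close>, and each of its points eventually belongs to
    them.\<close>
  have "\<forall>n. \<exists>x. (\<integral>\<^sup>+\<zeta>. (1 + D \<zeta>) * sqrt_kernel (x - Re \<zeta>) \<partial>T) < \<infinity> \<and> Re p < x \<and> x < Re p + e n"
    using e_pos by (intro allI good) auto
  from choice[OF this] obtain a where a: "\<And>n. (\<integral>\<^sup>+\<zeta>. (1 + D \<zeta>) * sqrt_kernel (a n - Re \<zeta>) \<partial>T) < \<infinity>"
      "\<And>n. Re p < a n" "\<And>n. a n < Re p + e n"
    by blast
  have "\<forall>n. \<exists>x. (\<integral>\<^sup>+\<zeta>. (1 + D \<zeta>) * sqrt_kernel (x - Re \<zeta>) \<partial>T) < \<infinity> \<and> Re q - e n < x \<and> x < Re q"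
    using e_pos by (intro allI good) auto
  from choice[OF this] obtain b where b: "\<And>n. (\<integral>\<^sup>+\<zeta>. (1 + D \<zeta>) * sqrt_kernel (b n - Re \<zeta>) \<partial>T) < \<infinity>"
      "\<And>n. Re q - e n < b n" "\<And>n. b n < Re q"
    by blast
  have "\<forall>n. \<exists>x. (\<integral>\<^sup>+\<zeta>. (1 + D \<zeta>) * sqrt_kernel (x - Im \<zeta>) \<partial>T) < \<infinity> \<and> Im p < x \<and> x < Im p + e n"
    using e_pos by (intro allI good) auto
  from choice[OF this] obtain c where c: "\<And>n. (\<integral>\<^sup>+\<zeta>. (1 + D \<zeta>) * sqrt_kernel (c n - Im \<zeta>) \<partial>T) < \<infinity>"
      "\<And>n. Im p < c n" "\<And>n. c n < Im p + e n"
    by blast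
  have "\<forall>n. \<exists>x. (\<integral>\<^sup>+\<zeta>. (1 + D \<zeta>) * sqrt_kernel (x - Im \<zeta>) \<partial>T) < \<infinity> \<and> Im q - e n < x \<and> x < Im q"
    using e_pos by (intro allI good) auto
  from choice[OF this] obtain d where d: "\<And>n. (\<integral>\<^sup>+\<zeta>. (1 + D \<zeta>) * sqrt_kernel (d n - Im \<zeta>) \<partial>T) < \<infinity>"
      "\<And>n. Im q - e n < d n" "\<And>n. d n < Im q"
    by blast
  have "(\<lambda>n. LINT \<zeta>|T. h \<zeta> * indicator (box (Complex (a n) (c n)) (Complex (b n) (d n))) \<zeta>)
          \<longlonglongrightarrow> (LINT \<zeta>|T. h \<zeta> * indicator (box p q) \<zeta>)"
  proof (rule integral_indicator_tendsto)
    fix \<zeta>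
    show "\<forall>\<^sub>F n in sequentially.
            \<zeta> \<in> box (Complex (a n) (c n)) (Complex (b n) (d n)) \<longleftrightarrow> \<zeta> \<in> box p q"
    proof (cases "\<zeta> \<in> box p q")
      case True
      have ev: "\<forall>\<^sub>F n in sequentially. e n < r" if "r > 0" for r
        using order_tendstoD(2)[OF e_lim that] .
      have "\<forall>\<^sub>F n in sequentially. e n < Re \<zeta> - Re p \<and> e n < Re q - Re \<zeta> \<and>
              e n < Im \<zeta> - Im p \<and> e n < Im q - Im \<zeta>"
        using True by (intro eventually_conj ev) (auto simp: in_box_complex_iff)
      thus ?thesis
      proof eventually_elim
        case (elim n)
        thus ?case using a(3)[of n] b(2)[of n] c(3)[of n] d(2)[of n] True
          by (auto simp: in_box_complex_iff)
      qed
    next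
      case False
      have "\<zeta> \<notin> box (Complex (a n) (c n)) (Complex (b n) (d n))" for n
        using False a(2)[of n] b(3)[of n] c(2)[of n] d(3)[of n] by (auto simp: in_box_complex_iff)
      thus ?thesis using False by simp
    qed
  qed auto
  thus ?thesis
    unfolding integral_box_eq_0_if_finite_potential[OF a(1) b(1) c(1) d(1)]
    by (simp add: LIMSEQ_const_iff)
qed

lemma integral_indicator_eq_0: "A \<in> sets borel \<Longrightarrow> (LINT \<zeta>|T. h \<zeta> * indicator A \<zeta>) = 0"
  by (rule integral_indicator_eq_0_if_boxes[OF integral_box_eq_0])

end

end

section \<open>Application to the total variation of \<mu>\<close>

text \<open>A block of a partition of \<open>{x}\<close> is nonempty and hence equals
  \<open>{x}\<close>. This carries the absence of atoms over from \<mu> to |\<mu>|.\<close>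

lemma variation_singleton_eq_0:
  assumes "\<mu> {x} = 0" shows "variation M \<mu> {x} = 0"
proof -
  have "(\<Sum>E\<in>P. ennreal (cmod (\<mu> E))) = 0" if "partition_on {x} P" for P
  proof (rule sum.neutral, rule ballI)
    fix E assume "E \<in> P"
    hence "E \<subseteq> {x}" "E \<noteq> {}" using that by (auto simp: partition_on_def)
    hence "E = {x}" by blast
    thus "ennreal (cmod (\<mu> E)) = 0" using assms by simp
  qed
  thus ?thesis unfolding variation_def le_zero_eq[symmetric] by (intro SUP_least) auto
qed

theorem theorem2p1:
  fixes \<mu> :: "complex set \<Rightarrow> complex"
  assumes "complex_measure borel \<mu>"
    and no_atoms: "\<And>z. \<mu> {z} = 0"
    and maximal_measurable: "cauchy_maximal \<mu> \<in> borel_measurable (total_variation borel \<mu>)"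
    and maximal_integrable: "(\<integral>\<^sup>+ z. cauchy_maximal \<mu> z \<partial>total_variation borel \<mu>) < \<infinity>"
    and cauchy_zero: "AE z in total_variation borel \<mu>. has_cauchy_integral \<mu> z 0"
  shows "\<forall>A \<in> sets borel. \<mu> A = 0"
proof -
  let ?T = "total_variation borel \<mu>"
  note \<mu> = assms(1)
  interpret T: finite_measure ?T by (rule finite_measure_total_variation[OF \<mu>])
  obtain h where h: "h \<in> borel_measurable borel" "\<And>x. cmod (h x) \<le> 4"
      "\<And>f. integrable ?T f \<Longrightarrow> complex_measure_integral borel \<mu> f = (LINT x|?T. h x * f x)"
      "\<And>A. A \<in> sets borel \<Longrightarrow> \<mu> A = (LINT x|?T. h x * indicator A x)"
    using complex_measure_density[OF \<mu>] by blast
  interpret bounded_density ?T h 4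
    by unfold_locales
      (simp_all add: h(1,2) emeasure_total_variation[OF \<mu>] variation_singleton_eq_0 no_atoms)
  \<comment> \<open>The density formula asks for integrability: for \<epsilon> > 0 the truncated
    kernel is bounded by 1 / \<epsilon>, and |\<mu>| is finite.\<close>
  have trunc: "cauchy_truncated \<mu> \<epsilon> z = trunc \<epsilon> z" if "\<epsilon> > 0" for \<epsilon> z
    unfolding cauchy_truncated_def trunc_def
  proof (rule h(3), rule T.integrable_const_bound[of _ "1 / \<epsilon>"])
    show "AE \<zeta> in ?T. norm (indicator {\<zeta>. \<epsilon> < cmod (\<zeta> - z)} \<zeta> *\<^sub>R (1 / (\<zeta> - z))) \<le> 1 / \<epsilon>"
      using that by (intro AE_I2) (auto simp: indicator_def norm_divide intro!: divide_left_mono mult_pos_pos)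
  qed measurable
  have le: "ennreal (cmod (trunc \<epsilon> z)) \<le> cauchy_maximal \<mu> z" if "\<epsilon> > 0" for \<epsilon> z
    unfolding cauchy_maximal_def using that by (intro SUP_upper2[of \<epsilon>]) (auto simp: trunc)
  have lim: "AE z in ?T. ((\<lambda>\<epsilon>. trunc \<epsilon> z) \<longlongrightarrow> 0) (at_right 0)"
    using cauchy_zero
  proof eventually_elim
    case (elim z)
    \<comment> \<open>The limit from the right sees only positive \<epsilon>, where both truncations
      agree.\<close>
    have "\<forall>\<^sub>F \<epsilon> in at_right 0. cauchy_truncated \<mu> \<epsilon> z = trunc \<epsilon> z"
      using trunc by (auto simp: eventually_at_filter)
    from tendsto_cong[OF this] elim show ?case unfolding has_cauchy_integral_def by blast
  qed
  have "cauchy_maximal \<mu> \<in> borel_measurable borel"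
    using maximal_measurable by (subst (asm) measurable_cong_sets[OF sets_T refl])
  \<comment> \<open>The maximal function is taken for \<open>D\<close>.\<close>
  note zero = integral_indicator_eq_0[OF this le maximal_integrable lim]
  show ?thesis
  proof
    fix A :: "complex set" assume "A \<in> sets borel"
    thus "\<mu> A = 0" by (simp only: h(4) zero)
  qed
qed

end
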